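(* Let $p\in(0,1)$ be a constant. There exists an $\varepsilon>0$ such that, with probability tending to $1$ as $n\to\infty$, the maximum size (number of vertices) of an induced tree in the binomial random graph $G(n,p)$ belongs to $\{f_{\varepsilon}(n),f_{\varepsilon}(n)+1\}$, where $$ f_{\varepsilon}(n)=\left\lfloor 2\log_{1/(1-p)}(enp)+2+\varepsilon\right\rfloor . $$
   Context: $G(n,p)$ is the binomial random graph on the vertex set $\{1,\ldots,n\}$: each of the $\binom{n}{2}$ possible edges is present independently with probability $p$. The edge probability $p\in(0,1)$ is a constant not depending on $n$. An induced tree in a graph $G$ is an induced subgraph of $G$ (the subgraph $G|_W$ on a vertex set $W$ containing all edges of $G$ with both endpoints in $W$) that is a tree; its size is $|W|$. In $enp$, $e$ is the base of the natural logarithm. The number $\varepsilon$ may depend on $p$ but not on $n$. *)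

theory Defs
  imports "HOL-Probability.Probability"
begin

text \<open>A graph is a pair of a vertex set and a set of two-element subsets of it. The well-formedness
  condition is not part of the type, but holds for every graph considered below.\<close>

type_synonym 'a ugraph = "'a set \<times> 'a set set"

abbreviation uverts :: "'a ugraph \<Rightarrow> 'a set" where
  "uverts G \<equiv> fst G"

abbreviation uedges :: "'a ugraph \<Rightarrow> 'a set set" where
  "uedges G \<equiv> snd G"

definition all_edges :: "'a set \<Rightarrow> 'a set set" where
  "all_edges V = {e. e \<subseteq> V \<and> card e = 2}"

definition induced_subgraph :: "'a ugraph \<Rightarrow> 'a set \<Rightarrow> 'a ugraph" where
  "induced_subgraph G W = (W, {e \<in> uedges G. e \<subseteq> W})"

text \<open>The null graph is not connected, hence not a tree.\<close>

definition connected_graph :: "'a ugraph \<Rightarrow> bool" where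
  "connected_graph G \<longleftrightarrow> uverts G \<noteq> {} \<and>
     (\<forall>u\<in>uverts G. \<forall>v\<in>uverts G. (u, v) \<in> {(x, y). {x, y} \<in> uedges G}\<^sup>*)"

text \<open>A cycle is given by the list of its vertices, without repeating the first one at the end.\<close>

definition is_cycle :: "'a ugraph \<Rightarrow> 'a list \<Rightarrow> bool" where
  "is_cycle G vs \<longleftrightarrow> length vs \<ge> 3 \<and> distinct vs \<and>
     (\<forall>i<length vs. {vs ! i, vs ! ((i + 1) mod length vs)} \<in> uedges G)"

definition is_tree :: "'a ugraph \<Rightarrow> bool" where
  "is_tree G \<longleftrightarrow> connected_graph G \<and> (\<nexists>vs. is_cycle G vs)"

text \<open>For a finite graph with at least one vertex the maximum is over a finite nonempty set,
  since a single vertex induces a tree. For the null graph the value is unspecified.\<close>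

definition max_induced_tree_size :: "'a ugraph \<Rightarrow> nat" where
  "max_induced_tree_size G = Max {card W |W. W \<subseteq> uverts G \<and> is_tree (induced_subgraph G W)}"

definition binomial_random_graph :: "nat \<Rightarrow> real \<Rightarrow> nat ugraph pmf" where
  "binomial_random_graph n p =
     map_pmf (\<lambda>present. ({1..n}, {e \<in> all_edges {1..n}. present e}))
       (Pi_pmf (all_edges {1..n}) False (\<lambda>_. bernoulli_pmf p))"

definition tree_threshold :: "real \<Rightarrow> real \<Rightarrow> nat \<Rightarrow> int" where
  "tree_threshold p \<epsilon> n = \<lfloor>2 * log (1 / (1 - p)) (exp 1 * real n * p) + 2 + \<epsilon>\<rfloor>"

end

theory Submission
  imports Defs "HOL-Real_Asymp.Real_Asymp"
begin

text \<open>
Write \<open>b = 1 / (1 - p)\<close>. By Cayley's formula there are \<open>k ^ (k - 2)\<close> trees on \<open>k\<close> given vertices, and each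
is induced with probability \<open>p ^ (k - 1) * (1 - p) ^ ((k - 1) * (k - 2) / 2)\<close>. By Stirling's formula the
expected number of induced trees with \<open>k\<close> vertices is therefore
\<open>b powr (k / 2 * (2 * log b (exp 1 * n * p) + 3 - k))\<close> up to factors polynomial in \<open>k\<close>. It is exponentially
large in \<open>k\<close> when \<open>k\<close> is below \<open>2 * log b (exp 1 * n * p) + 3\<close> by a fixed margin, and exponentially small
when it is above by a fixed margin. For \<open>0 < \<epsilon> < 1\<close> the threshold \<open>f\<close> is of the first kind and all sizes
from \<open>f + 2\<close> on are of the second kind. The proof takes \<open>\<epsilon> = 1/2\<close>.

No induced tree with \<open>f + 2\<close> or more vertices exists with high probability, by the first moment
(\<open>prob_large_induced_tree_le\<close>).

A tree of size \<open>k = f\<close> exists with high probability by the second moment method. The probability of no tree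
is at most a sum over the possible overlaps \<open>l \<ge> 1\<close> of two vertex sets of size \<open>k\<close>
(\<open>no_induced_tree_le_overlap_sum\<close>). The term for \<open>l\<close> is governed by the pairs of trees that agree on the
common vertices. If \<open>l \<le> k / 2\<close>, all pairs may be admitted: the overlap is rare enough, because \<open>n\<close> is of
order \<open>b powr (k / 2)\<close> (\<open>small_overlap_term_le\<close>). For \<open>l = k\<close> the term is the inverse of the expected
number of trees (\<open>full_overlap_term_le\<close>). For \<open>l\<close> in between, a tree may fall apart into many
components when it is restricted to the overlap, and each component can be reattached in many ways. Encoding
trees by parent functions with a root outside the overlap shows that such pairs are still few
(\<open>compatible_weight_le\<close>): reattaching the components contributes only a factor \<open>exp (O(j * sqrt k))\<close> for
\<open>j = k - l\<close>, against a gain of order \<open>b powr (- j * k / 4)\<close> (\<open>large_overlap_term_le\<close>).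
\<close>

section \<open>Rooted forests as parent functions\<close>

text \<open>A forest on \<open>V\<close> with set of roots \<open>R\<close> is encoded by its parent function on \<open>V - R\<close>. The height
  \<open>h\<close> certifies that iterating the parent function never runs into a cycle; on a finite \<open>V\<close> every
  vertex therefore ends up in \<open>R\<close>. Parent functions are extensional so that they can be counted.\<close>

definition rooted_forests :: "'a set \<Rightarrow> 'a set \<Rightarrow> ('a \<Rightarrow> 'a) set" where
  "rooted_forests V R =
     {f \<in> (V - R) \<rightarrow>\<^sub>E V. \<exists>h :: 'a \<Rightarrow> nat. \<forall>v\<in>V - R. h (f v) < h v}"

lemma finite_rooted_forests: "finite V \<Longrightarrow> finite (rooted_forests V R)"
  unfolding rooted_forests_def by (rule finite_subset[of _ "(V - R) \<rightarrow>\<^sub>E V"]) (auto intro: finite_PiE)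

lemma sum_over_subsets_by_card:
  fixes F :: "nat \<Rightarrow> 'b::comm_semiring_1"
  assumes "finite U"
  shows "(\<Sum>S\<in>Pow U. F (card S)) = (\<Sum>s\<le>card U. of_nat (card U choose s) * F s)"
proof -
  have "(\<Sum>S\<in>Pow U. F (card S)) = (\<Sum>s\<le>card U. \<Sum>S\<in>{S \<in> Pow U. card S = s}. F (card S))"
    using assms by (intro sum.group[symmetric]) (auto intro: card_mono)
  also have "\<dots> = (\<Sum>s\<le>card U. of_nat (card U choose s) * F s)"
  proof (intro sum.cong refl)
    fix s
    have "{S \<in> Pow U. card S = s} = {S. S \<subseteq> U \<and> card S = s}" by auto
    thus "(\<Sum>S\<in>{S \<in> Pow U. card S = s}. F (card S)) = of_nat (card U choose s) * F s"
      using n_subsets[OF assms, of s] by simp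
  qed
  finally show ?thesis .
qed

text \<open>After cancelling \<open>s\<close> against the binomial coefficient this is the binomial theorem with exponent
  \<open>M\<close>; it resolves the recursion for the number of rooted forests.\<close>

lemma binomial_first_moment:
  fixes r N :: nat
  shows "(\<Sum>s\<le>Suc M. (Suc M choose s) * (r ^ s * (s * N ^ (Suc M - s)))) = Suc M * (r * (r + N) ^ M)"
proof -
  have "(\<Sum>s\<le>Suc M. (Suc M choose s) * (r ^ s * (s * N ^ (Suc M - s))))
      = (\<Sum>i\<le>M. (Suc M choose Suc i) * (r ^ Suc i * (Suc i * N ^ (M - i))))"
    by (subst sum.atMost_Suc_shift) simp
  also have "\<dots> = (\<Sum>i\<le>M. Suc M * (r * ((M choose i) * r ^ i * N ^ (M - i))))"
  proof (intro sum.cong refl)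
    fix i
    have "(Suc M choose Suc i) * (r ^ Suc i * (Suc i * N ^ (M - i)))
        = (Suc i * (Suc M choose Suc i)) * (r ^ Suc i * N ^ (M - i))"
      by (simp only: mult_ac)
    also have "Suc i * (Suc M choose Suc i) = Suc M * (M choose i)"
      using Suc_times_binomial_eq[of M i] by (simp only: mult.commute)
    finally show "(Suc M choose Suc i) * (r ^ Suc i * (Suc i * N ^ (M - i)))
      = Suc M * (r * ((M choose i) * r ^ i * N ^ (M - i)))"
      by (simp only: mult_ac power_Suc)
  qed
  also have "\<dots> = Suc M * (r * (r + N) ^ M)"
    unfolding binomial[of r N M] by (simp add: sum_distrib_left)
  finally show ?thesis .
qed

text \<open>Cut a forest at its first generation \<open>S\<close>, the vertices whose parent is a root: each vertex of \<open>S\<close>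
  chooses its root freely, and what remains is a forest on \<open>V - R\<close> with roots \<open>S\<close>.\<close>

lemma card_rooted_forests_first_generation:
  assumes "finite V" "R \<subseteq> V"
  shows "card (rooted_forests V R)
    = (\<Sum>S\<in>Pow (V - R). card R ^ card S * card (rooted_forests (V - R) S))"
proof -
  define U where "U = V - R"
  have fin: "finite U" "finite R" using assms by (auto simp: U_def dest: finite_subset)
  define D where "D = (SIGMA S:Pow U. (S \<rightarrow>\<^sub>E R) \<times> rooted_forests U S)"
  define enc where "enc f = ({v \<in> U. f v \<in> R}, restrict f {v \<in> U. f v \<in> R},
      restrict f (U - {v \<in> U. f v \<in> R}))" for f :: "'a \<Rightarrow> 'a"
  have "bij_betw enc (rooted_forests V R) D"
  proof (rule bij_betw_byWitness[where f' = "\<lambda>(S, a, g) v. if v \<in> S then a v else g v"])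
    show "\<forall>f\<in>rooted_forests V R. (\<lambda>(S, a, g) v. if v \<in> S then a v else g v) (enc f) = f"
    proof
      fix f assume "f \<in> rooted_forests V R"
      hence "f \<in> U \<rightarrow>\<^sub>E V" by (simp add: rooted_forests_def U_def)
      hence "f v = undefined" if "v \<notin> U" for v using that by (rule PiE_arb)
      thus "(\<lambda>(S, a, g) v. if v \<in> S then a v else g v) (enc f) = f"
        by (simp add: enc_def fun_eq_iff)
    qed
    show "\<forall>x\<in>D. enc ((\<lambda>(S, a, g) v. if v \<in> S then a v else g v) x) = x"
    proof
      fix x assume "x \<in> D"
      then obtain S a g where x: "x = (S, a, g)" "S \<subseteq> U" "a \<in> S \<rightarrow>\<^sub>E R" "g \<in> rooted_forests U S"
        by (auto simp: D_def)
      have g: "g \<in> (U - S) \<rightarrow>\<^sub>E U" using x by (auto simp: rooted_forests_def)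
      have "{v \<in> U. (if v \<in> S then a v else g v) \<in> R} = S"
        using x(2,3) g by (auto simp: U_def PiE_def Pi_def)
      thus "enc ((\<lambda>(S, a, g) v. if v \<in> S then a v else g v) x) = x"
        using x(2,3) g by (auto simp: x(1) enc_def fun_eq_iff restrict_def PiE_def extensional_def)
    qed
    \<comment> \<open>The height of a forest also certifies the forest left after removing the roots.\<close>
    show "enc ` rooted_forests V R \<subseteq> D"
    proof
      fix x assume "x \<in> enc ` rooted_forests V R"
      then obtain f h where x: "x = enc f" and f: "f \<in> U \<rightarrow>\<^sub>E V" and h: "\<forall>v\<in>U. (h :: 'a \<Rightarrow> nat) (f v) < h v"
        by (auto simp: rooted_forests_def U_def)
      define S where "S = {v \<in> U. f v \<in> R}"
      have "restrict f (U - S) \<in> (U - S) \<rightarrow>\<^sub>E U"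
        using f by (auto simp: S_def U_def)
      moreover have "\<forall>v\<in>U - S. h (restrict f (U - S) v) < h v"
        using h by simp
      ultimately have "restrict f (U - S) \<in> rooted_forests U S"
        unfolding rooted_forests_def by blast
      moreover have "restrict f S \<in> S \<rightarrow>\<^sub>E R" by (auto simp: S_def)
      ultimately show "x \<in> D"
        unfolding x enc_def D_def S_def[symmetric] by (auto simp: S_def)
    qed
    show "(\<lambda>(S, a, g) v. if v \<in> S then a v else g v) ` D \<subseteq> rooted_forests V R"
    proof safe
      fix S a g assume "(S, a, g) \<in> D"
      hence x: "S \<subseteq> U" "a \<in> S \<rightarrow>\<^sub>E R" "g \<in> rooted_forests U S"
        by (auto simp: D_def)
      obtain h :: "'a \<Rightarrow> nat" where h: "\<forall>v\<in>U - S. h (g v) < h v"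
        using x by (auto simp: rooted_forests_def)
      have g: "g \<in> (U - S) \<rightarrow>\<^sub>E U" using x by (auto simp: rooted_forests_def)
      define f where "f = (\<lambda>v. if v \<in> S then a v else g v)"
      have f: "f \<in> (V - R) \<rightarrow>\<^sub>E V"
        using x(1,2) g assms(2) by (auto simp: f_def U_def PiE_def Pi_def extensional_def)
      \<comment> \<open>Raising all old heights by one makes room for the new roots at height zero.\<close>
      have "\<forall>v\<in>V - R. (if f v \<in> R then 0 else Suc (h (f v))) < (if v \<in> R then 0 else Suc (h v))"
        using x(1,2) h by (auto simp: f_def U_def PiE_def Pi_def)
      hence "f \<in> rooted_forests V R"
        unfolding rooted_forests_def
        using f by (intro CollectI conjI exI[of _ "\<lambda>v. if v \<in> R then 0 else Suc (h v)"])
      thus "(\<lambda>v. if v \<in> S then a v else g v) \<in> rooted_forests V R" by (simp add: f_def)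
    qed
  qed
  hence "card (rooted_forests V R) = card D" by (rule bij_betw_same_card)
  also have "\<dots> = (\<Sum>S\<in>Pow U. card ((S \<rightarrow>\<^sub>E R) \<times> rooted_forests U S))"
    unfolding D_def using fin
    by (intro card_SigmaI)
       (auto intro!: finite_cartesian_product finite_PiE finite_rooted_forests dest: finite_subset)
  also have "\<dots> = (\<Sum>S\<in>Pow U. card R ^ card S * card (rooted_forests U S))"
    using fin by (intro sum.cong refl) (auto simp: card_cartesian_product card_PiE dest: finite_subset)
  finally show ?thesis by (simp add: U_def)
qed

text \<open>The usual form of the count is \<open>r * k ^ (k - r - 1)\<close> with \<open>r\<close> roots among \<open>k\<close> vertices. The extra
  factor \<open>card V\<close> on the left avoids the exponent \<open>-1\<close> when all vertices are roots.\<close>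

lemma card_rooted_forests:
  assumes "finite V" "R \<subseteq> V"
  shows "card (rooted_forests V R) * card V = card R * card V ^ card (V - R)"
  using assms
proof (induction "card V" arbitrary: V R rule: less_induct)
  case less
  have finR: "finite R" using less.prems by (auto dest: finite_subset)
  define U where "U = V - R"
  have finU: "finite U" using less.prems by (auto simp: U_def)
  have cV: "card V = card R + card U"
    using less.prems finR by (metis U_def card_Diff_subset card_mono le_add_diff_inverse)
  consider "R = {}" | "R \<noteq> {}" "U = {}" | "R \<noteq> {}" "U \<noteq> {}" by blast
  thus ?case
  proof cases
    case 1
    have "card V = 0" if fV: "f \<in> rooted_forests V R" for f
    proof (rule ccontr)
      assume "card V \<noteq> 0"
      hence "V \<noteq> {}" by auto
      obtain h :: "'a \<Rightarrow> nat" where h: "\<forall>v\<in>V. h (f v) < h v" and f: "\<forall>v\<in>V. f v \<in> V"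
        using fV 1 by (auto simp: rooted_forests_def)
      obtain v where "v \<in> V" "\<forall>u\<in>V. h v \<le> h u"
        using \<open>V \<noteq> {}\<close> less.prems(1) by (metis arg_min_if_finite(1) arg_min_least)
      thus False using h f by (meson leD)
    qed
    hence "card (rooted_forests V R) = 0 \<or> card V = 0"
      by (metis card.empty ex_in_conv)
    thus ?thesis using 1 by auto
  next
    case 2
    hence "rooted_forests V R = {\<lambda>_. undefined}"
      unfolding rooted_forests_def U_def by auto
    thus ?thesis using 2 cV by (simp add: U_def[symmetric])
  next
    case 3
    then obtain M where M: "card U = Suc M"
      using finU by (metis card_0_eq not0_implies_Suc)
    have lt: "card U < card V" using 3 finR cV by (simp add: card_gt_0_iff)
    \<comment> \<open>The extra factor turns every count of the first-generation recursion into the form that the induction hypothesis evaluates.\<close>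
    have "card (rooted_forests V R) * Suc M
        = (\<Sum>S\<in>Pow U. card R ^ card S * (card (rooted_forests U S) * card U))"
      unfolding M[symmetric] card_rooted_forests_first_generation[OF less.prems] U_def[symmetric]
      by (simp add: sum_distrib_right mult.assoc)
    also have "\<dots> = (\<Sum>S\<in>Pow U. card R ^ card S * (card S * card U ^ (card U - card S)))"
    proof (intro sum.cong refl)
      fix S assume "S \<in> Pow U"
      hence "S \<subseteq> U" by simp
      thus "card R ^ card S * (card (rooted_forests U S) * card U)
        = card R ^ card S * (card S * card U ^ (card U - card S))"
        using less.hyps[OF lt finU \<open>S \<subseteq> U\<close>] finU
        by (simp add: card_Diff_subset finite_subset)
    qed
    also have "\<dots> = (\<Sum>s\<le>Suc M. (Suc M choose s) * (card R ^ s * (s * Suc M ^ (Suc M - s))))"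
      using sum_over_subsets_by_card[OF finU, of "\<lambda>s. card R ^ s * (s * card U ^ (card U - s))"]
      by (simp add: M)
    also have "\<dots> = Suc M * (card R * card V ^ M)"
      using binomial_first_moment[of M "card R" "Suc M"] by (simp only: cV M)
    finally have "card (rooted_forests V R) = card R * card V ^ M"
      by (metis mult.commute mult_left_cancel nat.distinct(1))
    thus ?thesis by (simp add: U_def[symmetric] M)
  qed
qed

section \<open>Trees and their parent functions\<close>

definition parent_edges :: "('a \<Rightarrow> 'a) \<Rightarrow> 'a set \<Rightarrow> 'a set set" where
  "parent_edges f D = (\<lambda>v. {v, f v}) ` D"

definition trees_on :: "'a set \<Rightarrow> 'a set set set" where
  "trees_on W = {E. E \<subseteq> all_edges W \<and> is_tree (W, E)}"

lemma finite_all_edges: "finite W \<Longrightarrow> finite (all_edges W)"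
  unfolding all_edges_def by (rule finite_subset[of _ "Pow W"]) auto

lemma card_all_edges: "finite W \<Longrightarrow> card (all_edges W) = card W choose 2"
  unfolding all_edges_def by (rule n_subsets)

lemma finite_trees_on: "finite W \<Longrightarrow> finite (trees_on W)"
  unfolding trees_on_def
  by (rule finite_subset[of _ "Pow (all_edges W)"]) (auto simp: finite_all_edges)

text \<open>A shortest walk from \<open>x\<close> to \<open>y\<close> that avoids the edge between them repeats no vertex, and it has at
  least two steps; the edge closes it to a cycle.\<close>

lemma cycle_if_edge_bridged:
  assumes "{x, y} \<in> E" "x \<noteq> y" and "(x, y) \<in> {(a, b). {a, b} \<in> E - {{x, y}}}\<^sup>*"
  shows "\<exists>vs. is_cycle (W, E) vs"
proof -
  define R where "R = {(a, b). {a, b} \<in> E - {{x, y}}}"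
  obtain n0 where "(x, y) \<in> R ^^ n0" using assms(3) rtrancl_imp_relpow R_def by metis
  define n where "n = (LEAST n. (x, y) \<in> R ^^ n)"
  have n: "(x, y) \<in> R ^^ n" unfolding n_def by (rule LeastI) fact
  have least: "n \<le> m" if "(x, y) \<in> R ^^ m" for m unfolding n_def by (rule Least_le) fact
  obtain f where f: "f 0 = x" "f n = y" "\<And>i. i < n \<Longrightarrow> (f i, f (Suc i)) \<in> R"
    using n unfolding relpow_fun_conv by blast
  have seg: "(f i, f j) \<in> R ^^ (j - i)" if "i \<le> j" "j \<le> n" for i j
    unfolding relpow_fun_conv using f(3) that by (intro exI[of _ "\<lambda>k. f (i + k)"]) auto
  have neq: "f i \<noteq> f j" if "i < j" "j \<le> n" for i j
  proof
    assume eq: "f i = f j"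
    have "(x, y) \<in> R ^^ (i + (n - j))"
      unfolding relpow_add using seg[of 0 i] seg[of j n] that eq f(1,2) by auto
    from least[OF this] show False using that by simp
  qed
  have inj: "inj_on f {0..<Suc n}"
    by (rule linorder_inj_onI) (use neq in auto)
  have n2: "n \<ge> 2"
  proof (rule ccontr)
    assume "\<not> n \<ge> 2"
    hence "n = 0 \<or> n = 1" by auto
    thus False using f assms(2) by (auto simp: R_def)
  qed
  have "is_cycle (W, E) (map f [0..<Suc n])"
    unfolding is_cycle_def
  proof (intro conjI allI impI)
    show "3 \<le> length (map f [0..<Suc n])" using n2 by simp
    show "distinct (map f [0..<Suc n])" using inj by (simp only: distinct_map distinct_upt set_upt simp_thms)
    fix i assume "i < length (map f [0..<Suc n])"
    hence i: "i < Suc n" by simp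
    have nthf: "map f [0..<Suc n] ! j = f j" if "j < Suc n" for j
      using that by (simp only: nth_map nth_upt length_upt) simp
    show "{map f [0..<Suc n] ! i, map f [0..<Suc n] ! ((i + 1) mod length (map f [0..<Suc n]))}
        \<in> uedges (W, E)"
    proof (cases "i < n")
      case True
      thus ?thesis using f(3)[OF True] nthf[of i] nthf[of "Suc i"] by (auto simp: R_def simp del: upt_Suc)
    next
      case False
      hence "i = n" using i by simp
      thus ?thesis using assms(1) nthf[of n] nthf[of 0] f(1,2)
        by (auto simp: insert_commute simp del: upt_Suc)
    qed
  qed
  thus ?thesis by blast
qed

lemma parent_path_to_root:
  assumes f: "f \<in> rooted_forests W {r}" and v: "v \<in> W"
  shows "(v, r) \<in> {(a, b). {a, b} \<in> parent_edges f (W - {r})}\<^sup>*"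
proof -
  obtain h :: "'a \<Rightarrow> nat" where h: "\<forall>v\<in>W - {r}. h (f v) < h v" and fW: "\<forall>v\<in>W-{r}. f v \<in> W"
    using f by (auto simp: rooted_forests_def)
  show ?thesis using v
  proof (induction "h v" arbitrary: v rule: less_induct)
    case less
    show ?case
    proof (cases "v = r")
      case False
      hence "(v, f v) \<in> {(a, b). {a, b} \<in> parent_edges f (W - {r})}"
        using less.prems by (auto simp: parent_edges_def)
      moreover have "(f v, r) \<in> {(a, b). {a, b} \<in> parent_edges f (W - {r})}\<^sup>*"
        using less False h fW by auto
      ultimately show ?thesis by (rule converse_rtrancl_into_rtrancl)
    qed simp
  qed
qed

text \<open>Each vertex reaches the root through its parents, so the graph is connected. On a cycle, both
  neighbours of a vertex of maximal height would have to be its parent, so there is no cycle.\<close>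

lemma parent_edges_tree:
  assumes "r \<in> W" and f: "f \<in> rooted_forests W {r}"
  shows "parent_edges f (W - {r}) \<in> trees_on W"
proof -
  define E where "E = parent_edges f (W - {r})"
  define Q where "Q = {(a, b). {a, b} \<in> E}"
  obtain h :: "'a \<Rightarrow> nat" where h: "\<forall>v\<in>W - {r}. h (f v) < h v" and fW: "\<forall>v\<in>W-{r}. f v \<in> W"
    using f by (auto simp: rooted_forests_def)
  have neq: "f v \<noteq> v" if "v \<in> W - {r}" for v using h that by (metis less_irrefl)
  have sub: "E \<subseteq> all_edges W"
  proof
    fix e assume "e \<in> E"
    then obtain v where v: "v \<in> W - {r}" "e = {v, f v}" by (auto simp: E_def parent_edges_def)
    thus "e \<in> all_edges W" using fW neq[of v] by (auto simp: all_edges_def card_2_iff)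
  qed
  have "sym Q" by (auto simp: Q_def sym_def insert_commute)
  have "(u, v) \<in> Q\<^sup>*" if "u \<in> W" "v \<in> W" for u v
    using parent_path_to_root[OF f that(1)] parent_path_to_root[OF f that(2)]
      sym_rtrancl[OF \<open>sym Q\<close>] unfolding E_def[symmetric] Q_def[symmetric]
    by (meson rtrancl_trans symD)
  hence conn: "connected_graph (W, E)"
    using assms(1) by (auto simp: connected_graph_def Q_def)
  have "\<not> is_cycle (W, E) vs" for vs
  proof
    assume "is_cycle (W, E) vs"
    hence len: "length vs \<ge> 3" and dist: "distinct vs"
      and edge: "\<And>i. i < length vs \<Longrightarrow> {vs ! i, vs ! ((i + 1) mod length vs)} \<in> E"
      by (auto simp: is_cycle_def)
    define n where "n = length vs"
    have n3: "n \<ge> 3" using len by (simp add: n_def)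
    obtain i where i: "i < n" and max: "\<And>j. j < n \<Longrightarrow> h (vs ! j) \<le> h (vs ! i)"
    proof -
      have i0: "0 \<in> {..<n}" using n3 by simp
      have "Max ((\<lambda>j. h (vs ! j)) ` {..<n}) \<in> (\<lambda>j. h (vs ! j)) ` {..<n}"
        by (intro Max_in) (use i0 in auto)
      then obtain i where "i < n" "h (vs ! i) = Max ((\<lambda>j. h (vs ! j)) ` {..<n})" by auto
      thus ?thesis using that by (metis (no_types, lifting) Max_ge finite_imageI finite_lessThan imageI lessThan_iff)
    qed
    have up: "vs ! j = f (vs ! i)" if j: "j < n" "{vs ! i, vs ! j} \<in> E" for j
    proof -
      obtain w where w: "w \<in> W - {r}" "{vs ! i, vs ! j} = {w, f w}"
        using j(2) by (auto simp: E_def parent_edges_def)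
      have "h (f w) < h w" using w h by blast
      thus ?thesis using w(2) max[OF j(1)] by (auto simp: doubleton_eq_iff)
    qed
    \<comment> \<open>The two neighbours of position \<open>i\<close> on the cycle, which differ because the cycle has length at least three.\<close>
    define a where "a = (i + 1) mod n"
    define c where "c = (if i = 0 then n - 1 else i - 1)"
    have an: "a < n" "c < n" "a \<noteq> c" using n3 i
      by (auto simp: a_def c_def mod_Suc)
    have "(c + 1) mod n = i" using i n3 by (auto simp: c_def)
    hence "{vs ! i, vs ! c} \<in> E" using edge[of c] an by (simp add: n_def insert_commute)
    moreover have "{vs ! i, vs ! a} \<in> E" using edge[of i] i by (simp add: n_def a_def)
    ultimately have "vs ! a = vs ! c" using up an by metis
    thus False using an dist by (simp add: nth_eq_iff_index_eq n_def)
  qed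
  thus ?thesis using conn sub by (simp add: trees_on_def is_tree_def E_def)
qed

text \<open>Let every vertex choose a neighbour closer to \<open>r\<close>. The chosen edges already connect the tree, so a
  further edge would close a cycle.\<close>

lemma tree_has_parent_function:
  assumes "r \<in> W" and E: "E \<in> trees_on W"
  shows "\<exists>f\<in>rooted_forests W {r}. E = parent_edges f (W - {r})"
proof -
  define Q where "Q = {(a, b). {a, b} \<in> E}"
  have sub: "E \<subseteq> all_edges W" and conn: "connected_graph (W, E)" and acyc: "\<nexists>vs. is_cycle (W, E) vs"
    using E by (auto simp: trees_on_def is_tree_def)
  have reach: "(v, r) \<in> Q\<^sup>*" if "v \<in> W" for v
    using conn that assms(1) by (auto simp: connected_graph_def Q_def)
  define d where "d v = (LEAST i. (v, r) \<in> Q ^^ i)" for v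
  have "\<exists>u. (v, u) \<in> Q \<and> d u < d v" if v: "v \<in> W - {r}" for v
  proof -
    obtain i0 where "(v, r) \<in> Q ^^ i0" using reach[of v] v rtrancl_imp_relpow by blast
    hence dv: "(v, r) \<in> Q ^^ d v" unfolding d_def by (rule LeastI)
    hence "d v \<noteq> 0" using v by (auto intro!: Nat.gr0I)
    then obtain m where m: "d v = Suc m" by (cases "d v") auto
    then obtain u where u: "(v, u) \<in> Q" "(u, r) \<in> Q ^^ m"
      using dv relpow_Suc_D2[of v r m Q] by auto
    have "d u \<le> m" unfolding d_def by (rule Least_le) fact
    thus ?thesis using u m by auto
  qed
  then obtain g where g: "\<And>v. v \<in> W - {r} \<Longrightarrow> (v, g v) \<in> Q \<and> d (g v) < d v" by metis
  define f where "f = restrict g (W - {r})"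
  have gW: "g v \<in> W" if "v \<in> W - {r}" for v
    using g[OF that] sub by (auto simp: Q_def all_edges_def)
  have f: "f \<in> rooted_forests W {r}"
    unfolding rooted_forests_def using g gW by (auto simp: f_def intro!: exI[of _ d])
  define P where "P = parent_edges f (W - {r})"
  have PE: "P \<subseteq> E" using g by (auto simp: P_def parent_edges_def f_def Q_def)
  moreover have "E \<subseteq> P"
  proof (rule ccontr)
    assume "\<not> E \<subseteq> P"
    then obtain e where e: "e \<in> E" "e \<notin> P" by blast
    then obtain x y where xy: "e = {x, y}" "x \<noteq> y" "x \<in> W" "y \<in> W"
      using sub by (auto simp: all_edges_def card_2_iff)
    define S where "S = {(a, b). {a, b} \<in> P}"
    have "sym S" by (auto simp: S_def sym_def insert_commute)
    have "(x, y) \<in> S\<^sup>*"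
      using parent_path_to_root[OF f xy(3)] parent_path_to_root[OF f xy(4)]
        sym_rtrancl[OF \<open>sym S\<close>] unfolding P_def[symmetric] S_def[symmetric]
      by (meson rtrancl_trans symD)
    moreover have "S \<subseteq> {(a, b). {a, b} \<in> E - {{x, y}}}"
      using PE e xy(1) by (auto simp: S_def)
    ultimately have "(x, y) \<in> {(a, b). {a, b} \<in> E - {{x, y}}}\<^sup>*"
      using rtrancl_mono by blast
    from cycle_if_edge_bridged[OF _ xy(2) this] acyc e xy(1) show False by blast
  qed
  ultimately show ?thesis using f by (auto simp: P_def)
qed

text \<open>The edges determine the orientation towards the root: reversing the edge above a vertex would force
  the edge above its parent, which is closer to the root, to be reversed as well, and so on
  down to the root, which has no edge above it.\<close>

lemma inj_on_parent_edges: "inj_on (\<lambda>f. parent_edges f (W - {r})) (rooted_forests W {r})"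
proof (rule inj_onI)
  fix f g assume f: "f \<in> rooted_forests W {r}" and g: "g \<in> rooted_forests W {r}"
    and eq: "parent_edges f (W - {r}) = parent_edges g (W - {r})"
  obtain h :: "'a \<Rightarrow> nat" where h: "\<forall>v\<in>W - {r}. h (f v) < h v"
    using f by (auto simp: rooted_forests_def)
  have "f v = g v" if "v \<in> W - {r}" for v
    using that
  proof (induction "h v" arbitrary: v rule: less_induct)
    case less
    have "{v, f v} \<in> parent_edges g (W - {r})"
      using less.prems unfolding eq[symmetric] by (auto simp: parent_edges_def)
    then obtain w where w: "w \<in> W - {r}" "{v, f v} = {w, g w}" by (auto simp: parent_edges_def)
    show ?case
    proof (cases "w = v")
      case True
      thus ?thesis using w by (auto simp: doubleton_eq_iff)
    next
      case False
      hence *: "w = f v" "g w = v" using w by (auto simp: doubleton_eq_iff)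
      hence "h w < h v" using h less.prems by auto
      hence "f w = g w" using less w by auto
      hence "h v < h w" using h w * by metis
      thus ?thesis using \<open>h w < h v\<close> by simp
    qed
  qed
  thus "f = g" using f g
    by (intro PiE_ext[of _ "W - {r}" "\<lambda>_. W"]) (auto simp: rooted_forests_def)
qed

lemma trees_on_eq_parent_edges:
  assumes "r \<in> W"
  shows "trees_on W = (\<lambda>f. parent_edges f (W - {r})) ` rooted_forests W {r}"
  using parent_edges_tree[OF assms] tree_has_parent_function[OF assms] by blast

text \<open>Cayley's formula \<open>k ^ (k - 2)\<close>, multiplied by \<open>k\<^sup>2\<close> to avoid the truncated exponent for \<open>k = 1\<close>.\<close>

theorem Cayley_formula:
  assumes "finite W" "W \<noteq> {}"
  shows "card (trees_on W) * card W ^ 2 = card W ^ card W"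
proof -
  obtain r where r: "r \<in> W" using assms by blast
  have "card (trees_on W) = card (rooted_forests W {r})"
    unfolding trees_on_eq_parent_edges[OF r] by (rule card_image[OF inj_on_parent_edges])
  moreover have "card (rooted_forests W {r}) * card W = card W ^ (card W - 1)"
    using card_rooted_forests[of W "{r}"] assms r by simp
  moreover have "card W ^ (card W - 1) * card W = card W ^ card W"
    by (rule power_minus_mult) (use assms in \<open>simp add: card_gt_0_iff\<close>)
  ultimately show ?thesis
    by (simp add: power2_eq_square mult.assoc[symmetric])
qed

lemma inj_on_parent_edge:
  assumes "f \<in> rooted_forests W {r}"
  shows "inj_on (\<lambda>v. {v, f v}) (W - {r})"
proof -
  obtain h :: "'a \<Rightarrow> nat" where h: "\<forall>v\<in>W - {r}. h (f v) < h v"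
    using assms by (auto simp: rooted_forests_def)
  show ?thesis
  proof (rule inj_onI)
    fix u v assume uv: "u \<in> W - {r}" "v \<in> W - {r}" "{u, f u} = {v, f v}"
    have "h (f u) < h u" "h (f v) < h v" using uv h by blast+
    thus "u = v" using uv(3) by (auto simp: doubleton_eq_iff)
  qed
qed

lemma card_tree_edges:
  assumes "finite W" "W \<noteq> {}" "E \<in> trees_on W"
  shows "card E = card W - 1"
proof -
  obtain r where r: "r \<in> W" using assms by blast
  obtain f where f: "f \<in> rooted_forests W {r}" "E = parent_edges f (W - {r})"
    using tree_has_parent_function[OF r assms(3)] by blast
  have "card E = card (W - {r})"
    unfolding f(2) parent_edges_def by (rule card_image[OF inj_on_parent_edge[OF f(1)]])
  thus ?thesis using r assms by simp
qed

section \<open>Pairs of trees that agree on their common vertices\<close>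

text \<open>Exactly these pairs of trees can be simultaneously induced on \<open>V\<close> and on \<open>W\<close> by one graph.\<close>

definition compatible_trees :: "'a set \<Rightarrow> 'a set \<Rightarrow> ('a set set \<times> 'a set set) set" where
  "compatible_trees V W =
     {(S, T). S \<in> trees_on V \<and> T \<in> trees_on W \<and> S \<inter> all_edges W = T \<inter> all_edges V}"

lemma finite_compatible_trees:
  assumes "finite V" "finite W"
  shows "finite (compatible_trees V W)"
  by (rule finite_subset[of _ "trees_on V \<times> trees_on W"])
     (use assms in \<open>auto simp: compatible_trees_def finite_trees_on\<close>)

lemma all_edges_Int: "all_edges (V \<inter> W) = all_edges V \<inter> all_edges W"
  by (auto simp: all_edges_def)

lemma card_parent_edges:
  assumes "f \<in> rooted_forests W {r}" "D \<subseteq> W - {r}"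
  shows "card (parent_edges f D) = card D"
  unfolding parent_edges_def
  by (rule card_image[OF inj_on_subset[OF inj_on_parent_edge[OF assms(1)] assms(2)]])

text \<open>The edge above \<open>v\<close> lies inside \<open>L\<close> unless \<open>v\<close> is the top of a component of the forest induced on
  \<open>L\<close>. The root lies outside \<open>L\<close>, so that all vertices of \<open>L\<close> have a parent.\<close>

lemma parent_edges_within:
  assumes f: "f \<in> rooted_forests W {r}" and L: "L \<subseteq> W - {r}"
  shows "parent_edges f (W - {r}) \<inter> all_edges L = parent_edges f (L - {v \<in> L. f v \<notin> L})"
proof -
  obtain h :: "'a \<Rightarrow> nat" where h: "\<forall>v\<in>W - {r}. h (f v) < h v"
    using f by (auto simp: rooted_forests_def)
  have neq: "v \<noteq> f v" if "v \<in> W - {r}" for v using h that by (metis less_irrefl)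
  have "{v, f v} \<in> all_edges L \<longleftrightarrow> v \<in> L \<and> f v \<in> L" if "v \<in> W - {r}" for v
    using neq[OF that] by (auto simp: all_edges_def)
  thus ?thesis using L unfolding parent_edges_def by auto
qed

lemma sum_subset_pairs_by_card:
  fixes F :: "nat \<Rightarrow> real"
  assumes "finite L"
  shows "(\<Sum>(A, B)\<in>Pow L \<times> Pow L. if card A = card B then F (card A) else 0)
       = (\<Sum>m\<le>card L. (card L choose m)\<^sup>2 * F m)"
proof -
  have "(\<Sum>(A, B)\<in>Pow L \<times> Pow L. if card A = card B then F (card A) else 0)
      = (\<Sum>A\<in>Pow L. \<Sum>B\<in>Pow L. if card A = card B then F (card A) else 0)"
    by (simp add: sum.cartesian_product)
  also have "\<dots> = (\<Sum>A\<in>Pow L. (card L choose card A) * F (card A))"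
  proof (intro sum.cong refl)
    fix A assume "A \<in> Pow L"
    hence le: "card A \<le> card L" using assms by (auto intro: card_mono)
    have "(\<Sum>B\<in>Pow L. if card A = card B then F (card A) else 0)
        = (\<Sum>s\<le>card L. (card L choose s) * (if card A = s then F (card A) else 0))"
      using sum_over_subsets_by_card[OF assms, of "\<lambda>s. if card A = s then F (card A) else 0"] by simp
    also have "\<dots> = (\<Sum>s\<le>card L. if card A = s then (card L choose s) * F (card A) else 0)"
      by (intro sum.cong) auto
    also have "\<dots> = (card L choose card A) * F (card A)" using le by simp
    finally show "(\<Sum>B\<in>Pow L. if card A = card B then F (card A) else 0)
        = (card L choose card A) * F (card A)" .
  qed
  also have "\<dots> = (\<Sum>m\<le>card L. (card L choose m) * ((card L choose m) * F m))"
    using sum_over_subsets_by_card[OF assms, of "\<lambda>s. (card L choose s) * F s"] by simp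
  finally show ?thesis by (simp add: power2_eq_square mult.assoc)
qed

lemma card_tree_Int_le:
  assumes "finite V" "L \<subseteq> V" "L \<noteq> V" "T \<in> trees_on V"
  shows "card (T \<inter> all_edges L) \<le> card L"
proof -
  obtain r where r: "r \<in> V - L" using assms by blast
  obtain f where f: "f \<in> rooted_forests V {r}" "T = parent_edges f (V - {r})"
    using tree_has_parent_function[of r V T] r assms by blast
  have L: "L \<subseteq> V - {r}" using r assms by blast
  have "card (T \<inter> all_edges L) = card (L - {v \<in> L. f v \<notin> L})"
    unfolding f(2) parent_edges_within[OF f(1) L] using L by (intro card_parent_edges[OF f(1)]) auto
  also have "\<dots> \<le> card L" using assms by (intro card_mono) (auto dest: finite_subset)
  finally show ?thesis .
qed

text \<open>This bound ignores compatibility altogether and only uses that a forest has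
  no more edges than vertices.
  It is strong enough when the overlap is at most half of a tree.\<close>

lemma compatible_weight_le_trivial:
  fixes x :: real
  assumes "finite V" "finite W" "V \<inter> W \<noteq> V" "0 \<le> x"
  shows "(\<Sum>(S, T)\<in>compatible_trees V W. x ^ card (S \<inter> all_edges W))
    \<le> card (trees_on V) * card (trees_on W) * max 1 x ^ card (V \<inter> W)"
proof -
  have "(\<Sum>(S, T)\<in>compatible_trees V W. x ^ card (S \<inter> all_edges W))
      \<le> (\<Sum>(S, T)\<in>trees_on V \<times> trees_on W. max 1 x ^ card (V \<inter> W))"
  proof (rule sum_le_included[where i = id])
    show "\<forall>y\<in>compatible_trees V W. \<exists>z\<in>trees_on V \<times> trees_on W. id z = y \<and>
        (case y of (S, T) \<Rightarrow> x ^ card (S \<inter> all_edges W)) \<le> (case z of (S, T) \<Rightarrow> max 1 x ^ card (V \<inter> W))"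
    proof
      fix y assume "y \<in> compatible_trees V W"
      then obtain S T where y: "y = (S, T)" "S \<in> trees_on V" "T \<in> trees_on W"
        by (auto simp: compatible_trees_def)
      have "S \<inter> all_edges W = S \<inter> all_edges (V \<inter> W)"
        using y(2) by (auto simp: all_edges_Int trees_on_def)
      hence "card (S \<inter> all_edges W) \<le> card (V \<inter> W)"
        using card_tree_Int_le[of V "V \<inter> W" S] assms y(2) by auto
      have "x ^ card (S \<inter> all_edges W) \<le> max 1 x ^ card (S \<inter> all_edges W)"
        using assms by (intro power_mono) auto
      also have "\<dots> \<le> max 1 x ^ card (V \<inter> W)"
        using \<open>card (S \<inter> all_edges W) \<le> card (V \<inter> W)\<close> by (intro power_increasing) auto
      finally show "\<exists>z\<in>trees_on V \<times> trees_on W. id z = y \<and>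
          (case y of (S, T) \<Rightarrow> x ^ card (S \<inter> all_edges W)) \<le> (case z of (S, T) \<Rightarrow> max 1 x ^ card (V \<inter> W))"
        using y by auto
    qed
  qed (use assms in \<open>auto simp: finite_trees_on finite_compatible_trees\<close>)
  also have "\<dots> = card (trees_on V) * card (trees_on W) * max 1 x ^ card (V \<inter> W)"
    by (simp add: case_prod_beta card_cartesian_product)
  finally show ?thesis .
qed

text \<open>For a large overlap the trees on \<open>V\<close> and \<open>W\<close> are far from independent, and compatible pairs are
  counted as follows. Root both trees outside the overlap \<open>L\<close>. Let \<open>A\<close> and \<open>B\<close> be the sets of vertices
  of \<open>L\<close> whose parents in the first and in the second tree lie outside \<open>L\<close>. Both have one element in each
  component of the common forest, hence the same size \<open>m\<close>. Given \<open>A\<close> and \<open>B\<close>, the pair is determined by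
  the first parent function and the second one outside \<open>L - B\<close>, as the remaining edges of the second tree
  are those of the common forest, which the first tree provides. The choices number at most \<open>j\<close> for a
  vertex of \<open>A\<close> or \<open>B\<close>, \<open>l\<close> for a vertex of \<open>L - A\<close>, and \<open>k\<close> for a vertex outside the overlap.
  The count thus costs a factor \<open>l choose m\<close> for each of \<open>A\<close> and \<open>B\<close>, but gains a power
  \<open>l ^ (- m)\<close>; this is what keeps forests with many components harmless.\<close>

lemma compatible_weight_le:
  fixes x :: real
  assumes fin: "finite V" "finite W" and card: "card V = k" "card W = k" "card (V \<inter> W) = l"
    and lk: "k = l + j" "j > 0" and x: "0 \<le> x"
  shows "(\<Sum>(S, T)\<in>compatible_trees V W. x ^ card (S \<inter> all_edges W))
    \<le> (\<Sum>m\<le>l. (real (l choose m))\<^sup>2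
           * (x ^ (l - m) * (real l ^ (l - m) * real j ^ (2 * m) * real k ^ (2 * j))))"
proof -
  define L where "L = V \<inter> W"
  have finL: "finite L" and cL: "card L = l" using fin card by (auto simp: L_def)
  have cVL: "card (V - L) = j" "card (W - L) = j"
    using card lk fin by (auto simp: L_def card_Diff_subset_Int Int_commute Int_left_commute)
  obtain r where r: "r \<in> V" "r \<notin> L" using cVL lk by (metis Diff_iff card.empty ex_in_conv less_irrefl)
  obtain s where s: "s \<in> W" "s \<notin> L" using cVL lk by (metis Diff_iff card.empty ex_in_conv less_irrefl)
  have LV: "L \<subseteq> V - {r}" and LW: "L \<subseteq> W - {s}" using r s by (auto simp: L_def)
  obtain P where P: "\<And>S. S \<in> trees_on V \<Longrightarrow> P S \<in> rooted_forests V {r} \<and> S = parent_edges (P S) (V - {r})"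
    using tree_has_parent_function[OF r(1)] by metis
  obtain Q where Q: "\<And>T. T \<in> trees_on W \<Longrightarrow> Q T \<in> rooted_forests W {s} \<and> T = parent_edges (Q T) (W - {s})"
    using tree_has_parent_function[OF s(1)] by metis
  define \<rho> where "\<rho> S = {v \<in> L. P S v \<notin> L}" for S
  define \<sigma> where "\<sigma> T = {v \<in> L. Q T v \<notin> L}" for T
  have subL: "\<rho> S \<subseteq> L" "\<sigma> T \<subseteq> L" for S T by (auto simp: \<rho>_def \<sigma>_def)
  have inner: "S \<inter> all_edges L = parent_edges (P S) (L - \<rho> S)" if "S \<in> trees_on V" for S
    using parent_edges_within[of "P S" V r L] P[OF that] LV by (auto simp: \<rho>_def)
  have inner': "T \<inter> all_edges L = parent_edges (Q T) (L - \<sigma> T)" if "T \<in> trees_on W" for T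
    using parent_edges_within[of "Q T" W s L] Q[OF that] LW by (auto simp: \<sigma>_def)
  have common: "S \<inter> all_edges W = S \<inter> all_edges L \<and> S \<inter> all_edges L = T \<inter> all_edges L
      \<and> S \<in> trees_on V \<and> T \<in> trees_on W"
    if "(S, T) \<in> compatible_trees V W" for S T
    using that unfolding compatible_trees_def L_def all_edges_Int trees_on_def by auto
  have cS: "card (S \<inter> all_edges L) = l - card (\<rho> S)" if "S \<in> trees_on V" for S
  proof -
    have "card (S \<inter> all_edges L) = card (L - \<rho> S)"
      unfolding inner[OF that] using P[OF that] LV by (intro card_parent_edges[of _ V r]) auto
    also have "\<dots> = l - card (\<rho> S)"
      using card_Diff_subset[OF finite_subset[OF subL(1) finL] subL(1)] cL by simp
    finally show ?thesis .
  qed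
  have cT: "card (T \<inter> all_edges L) = l - card (\<sigma> T)" if "T \<in> trees_on W" for T
  proof -
    have "card (T \<inter> all_edges L) = card (L - \<sigma> T)"
      unfolding inner'[OF that] using Q[OF that] LW by (intro card_parent_edges[of _ W s]) auto
    also have "\<dots> = l - card (\<sigma> T)"
      using card_Diff_subset[OF finite_subset[OF subL(2) finL] subL(2)] cL by simp
    finally show ?thesis .
  qed
  have cle: "card (\<rho> S) \<le> l" "card (\<sigma> T) \<le> l" for S T
    using subL finL cL by (metis card_mono)+
  define \<Phi> where "\<Phi> = (\<lambda>(S, T). (\<rho> S, \<sigma> T))"
  define N where "N m = l ^ (l - m) * j ^ (2 * m) * k ^ (2 * j)" for m
  have fiber: "card {y \<in> compatible_trees V W. \<Phi> y = (A, B)} \<le> N (card A)"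
    if AB: "A \<subseteq> L" "B \<subseteq> L" "card A = card B" for A B
  proof -
    define C1 where "C1 = PiE (V - {r}) (\<lambda>v. if v \<in> A then V - L else if v \<in> L then L else V)"
    define C2 where "C2 = PiE (W - {s} - (L - B)) (\<lambda>v. if v \<in> B then W - L else W)"
    define enc where "enc = (\<lambda>(S, T). (P S, restrict (Q T) (W - {s} - (L - B))))"
    have "inj_on enc {y \<in> compatible_trees V W. \<Phi> y = (A, B)}"
    proof (rule inj_onI, clarify)
      fix S T S' T' assume st: "(S, T) \<in> compatible_trees V W" "(S', T') \<in> compatible_trees V W"
        and ph: "\<Phi> (S, T) = (A, B)" "\<Phi> (S', T') = (A, B)" and eq: "enc (S, T) = enc (S', T')"
      have *: "S \<in> trees_on V" "S' \<in> trees_on V" "T \<in> trees_on W" "T' \<in> trees_on W"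
        using common[OF st(1)] common[OF st(2)] by auto
      have "P S = P S'" using eq by (simp add: enc_def)
      hence S: "S = S'" using P[OF *(1)] P[OF *(2)] by metis
      \<comment> \<open>The second tree consists of its part inside the overlap, which the first tree fixes, and the edges recorded by the encoding.\<close>
      have split: "U = (U \<inter> all_edges L) \<union> parent_edges (restrict (Q U) (W - {s} - (L - B))) (W - {s} - (L - B))"
        if U: "U \<in> trees_on W" "\<sigma> U = B" for U
      proof -
        have "W - {s} = (L - B) \<union> (W - {s} - (L - B))" using LW by auto
        hence "U = parent_edges (Q U) ((L - B) \<union> (W - {s} - (L - B)))" using Q[OF U(1)] by metis
        also have "\<dots> = parent_edges (Q U) (L - B) \<union> parent_edges (Q U) (W - {s} - (L - B))"
          by (simp only: parent_edges_def image_Un)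
        also have "parent_edges (Q U) (L - B) = U \<inter> all_edges L" using inner'[OF U(1)] U(2) by simp
        also have "parent_edges (Q U) (W - {s} - (L - B))
            = parent_edges (restrict (Q U) (W - {s} - (L - B))) (W - {s} - (L - B))"
          by (simp add: parent_edges_def)
        finally show ?thesis .
      qed
      have "T \<inter> all_edges L = T' \<inter> all_edges L"
        using common[OF st(1)] common[OF st(2)] S by auto
      moreover have "\<sigma> T = B" "\<sigma> T' = B" using ph by (auto simp: \<Phi>_def)
      moreover have "restrict (Q T) (W - {s} - (L - B)) = restrict (Q T') (W - {s} - (L - B))"
        using eq by (simp add: enc_def)
      ultimately have "T = T'" using split[OF *(3)] split[OF *(4)] by metis
      with S show "S = S' \<and> T = T'" by simp
    qed
    moreover have "enc ` {y \<in> compatible_trees V W. \<Phi> y = (A, B)} \<subseteq> C1 \<times> C2"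
    proof (rule image_subsetI)
      fix y assume y: "y \<in> {y \<in> compatible_trees V W. \<Phi> y = (A, B)}"
      obtain S T where yST: "y = (S, T)" by fastforce
      have st: "(S, T) \<in> compatible_trees V W" and ph: "\<Phi> (S, T) = (A, B)"
        using y yST by auto
      have "P S \<in> (V - {r}) \<rightarrow>\<^sub>E V" "Q T \<in> (W - {s}) \<rightarrow>\<^sub>E W"
        using P[of S] Q[of T] common[OF st] by (auto simp: rooted_forests_def)
      moreover have "A = {v \<in> L. P S v \<notin> L}" "B = {v \<in> L. Q T v \<notin> L}"
        using ph by (auto simp: \<Phi>_def \<rho>_def \<sigma>_def)
      ultimately show "enc y \<in> C1 \<times> C2"
        unfolding yST enc_def C1_def C2_def by (auto simp: PiE_iff)
    qed
    moreover have "finite C1" "finite C2"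
      unfolding C1_def C2_def using fin finL by (auto intro!: finite_PiE split: if_splits)
    ultimately have "card {y \<in> compatible_trees V W. \<Phi> y = (A, B)} \<le> card (C1 \<times> C2)"
      by (intro card_inj_on_le[of enc]) auto
    also have "\<dots> = card C1 * card C2" by (rule card_cartesian_product)
    also have "\<dots> \<le> (j ^ card A * l ^ (l - card A) * k ^ j) * (j ^ card B * k ^ j)"
    proof (rule mult_mono)
      have dj: "V - {r} = A \<union> ((L - A) \<union> (V - L - {r}))" using AB LV by auto
      have finA: "finite A" using AB finL by (auto dest: finite_subset)
      have k0: "k \<ge> 1" using lk by simp
      have "card C1 = (\<Prod>v\<in>A \<union> ((L - A) \<union> (V - L - {r})). card (if v \<in> A then V - L else if v \<in> L then L else V))"
        unfolding C1_def using fin by (subst card_PiE) (auto simp: dj[symmetric])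
      also have "\<dots> = (\<Prod>v\<in>A. j) * ((\<Prod>v\<in>L - A. l) * (\<Prod>v\<in>V - L - {r}. k))"
      proof -
        have "finite (L - A)" "finite (V - L - {r})" "A \<inter> ((L - A) \<union> (V - L - {r})) = {}"
          "(L - A) \<inter> (V - L - {r}) = {}" using finL fin AB by auto
        thus ?thesis using AB finA cVL cL card
          by (simp only: prod.union_disjoint finite_Un)
             (intro arg_cong2[of _ _ _ _ "(*)"] prod.cong refl; auto)
      qed
      also have "\<dots> = j ^ card A * (l ^ (l - card A) * k ^ (j - 1))"
        using AB finA cL cVL r by (simp add: card_Diff_subset)
      also have "\<dots> \<le> j ^ card A * (l ^ (l - card A) * k ^ j)"
        using k0 by (intro mult_left_mono power_increasing) auto
      finally show "card C1 \<le> j ^ card A * l ^ (l - card A) * k ^ j" by (simp add: mult.assoc)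
      have dj: "W - {s} - (L - B) = B \<union> (W - L - {s})" using AB LW by auto
      have finB: "finite B" using AB finL by (auto dest: finite_subset)
      have "card C2 = (\<Prod>v\<in>B \<union> (W - L - {s}). card (if v \<in> B then W - L else W))"
        unfolding C2_def using fin finB by (subst card_PiE) (auto simp: dj)
      also have "\<dots> = (\<Prod>v\<in>B. j) * (\<Prod>v\<in>W - L - {s}. k)"
      proof -
        have "finite (W - L - {s})" "B \<inter> (W - L - {s}) = {}" using fin AB by auto
        thus ?thesis using AB finB cVL card
          by (simp only: prod.union_disjoint)
             (intro arg_cong2[of _ _ _ _ "(*)"] prod.cong refl; auto)
      qed
      also have "\<dots> = j ^ card B * k ^ (j - 1)"
        using AB finB cL cVL s by (simp add: card_Diff_subset)
      also have "\<dots> \<le> j ^ card B * k ^ j"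
        using k0 by (intro mult_left_mono power_increasing) auto
      finally show "card C2 \<le> j ^ card B * k ^ j" .
    qed auto
    also have "\<dots> = N (card A)"
      unfolding N_def AB(3) power_mult_distrib mult_2 power_add by (simp only: mult_ac)
    finally show ?thesis .
  qed
  have finC: "finite (compatible_trees V W)" using fin by (rule finite_compatible_trees)
  have "(\<Sum>(S, T)\<in>compatible_trees V W. x ^ card (S \<inter> all_edges W))
      = (\<Sum>(S, T)\<in>compatible_trees V W. x ^ (l - card (\<rho> S)))"
  proof (intro sum.cong refl, clarify)
    fix S T assume "(S, T) \<in> compatible_trees V W"
    thus "x ^ card (S \<inter> all_edges W) = x ^ (l - card (\<rho> S))"
      using common cS by metis
  qed
  also have "\<dots> = (\<Sum>z\<in>Pow L \<times> Pow L. \<Sum>(S, T)\<in>{y \<in> compatible_trees V W. \<Phi> y = z}. x ^ (l - card (\<rho> S)))"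
    using finC finL subL by (intro sum.group[symmetric]) (auto simp: \<Phi>_def)
  also have "\<dots> \<le> (\<Sum>(A, B)\<in>Pow L \<times> Pow L. if card A = card B then x ^ (l - card A) * N (card A) else 0)"
  proof (intro sum_mono, clarify)
    fix A B assume AB: "A \<subseteq> L" "B \<subseteq> L"
    let ?Y = "{y \<in> compatible_trees V W. \<Phi> y = (A, B)}"
    have eq: "(\<Sum>(S, T)\<in>?Y. x ^ (l - card (\<rho> S))) = card ?Y * x ^ (l - card A)"
    proof -
      have "(\<Sum>(S, T)\<in>?Y. x ^ (l - card (\<rho> S))) = (\<Sum>_\<in>?Y. x ^ (l - card A))"
        by (intro sum.cong) (auto simp: \<Phi>_def)
      thus ?thesis by simp
    qed
    show "(\<Sum>(S, T)\<in>?Y. x ^ (l - card (\<rho> S)))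
        \<le> (if card A = card B then x ^ (l - card A) * real (N (card A)) else 0)"
    proof (cases "card A = card B")
      case True
      have "real (card ?Y) \<le> real (N (card A))" using fiber[OF AB True] by (rule of_nat_mono)
      hence "real (card ?Y) * x ^ (l - card A) \<le> real (N (card A)) * x ^ (l - card A)"
        using x by (intro mult_right_mono) auto
      thus ?thesis unfolding eq using True by (simp add: mult.commute)
    next
      case False
      \<comment> \<open>The common forest has as many components as either set of tops has elements.\<close>
      have "?Y = {}"
      proof (rule ccontr)
        assume "?Y \<noteq> {}"
        then obtain S T where st: "(S, T) \<in> compatible_trees V W" "\<rho> S = A" "\<sigma> T = B"
          by (auto simp: \<Phi>_def)
        have "l - card A = l - card B"
          using cS[of S] cT[of T] common[OF st(1)] st(2,3) by metis
        thus False using False cle(1)[of S] cle(2)[of T] st(2,3) by auto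
      qed
      thus ?thesis using False by (simp only: eq) simp
    qed
  qed
  also have "\<dots> = (\<Sum>m\<le>l. (l choose m)\<^sup>2 * (x ^ (l - m) * N m))"
    using sum_subset_pairs_by_card[OF finL, of "\<lambda>m. x ^ (l - m) * N m"] cL by simp
  finally show ?thesis by (simp add: N_def)
qed

section \<open>Induced trees in the random graph\<close>

lemma prob_in_finite_set:
  fixes M :: "'a pmf"
  assumes "finite F"
  shows "measure_pmf.prob M {\<omega>. X \<omega> \<in> F} = (\<Sum>x\<in>F. measure_pmf.prob M {\<omega>. X \<omega> = x})"
  using measure_measure_pmf_finite[OF assms, of "map_pmf X M"]
  by (simp add: pmf_map vimage_def)

text \<open>Chebyshev's inequality for the number of events that occur: if none occurs, this number deviates from
  its mean \<open>\<mu>\<close> by \<open>\<mu>\<close>.\<close>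

lemma second_moment_bound:
  fixes M :: "'a pmf" and A :: "'i \<Rightarrow> 'a set"
  assumes fin: "finite I"
  defines "\<mu> \<equiv> (\<Sum>i\<in>I. measure_pmf.prob M (A i))"
  shows "(1 - measure_pmf.prob M (\<Union>i\<in>I. A i)) * \<mu>\<^sup>2
    \<le> (\<Sum>i\<in>I. \<Sum>j\<in>I. measure_pmf.prob M (A i \<inter> A j)) - \<mu>\<^sup>2"
proof -
  define X where "X \<omega> = (\<Sum>i\<in>I. indicat_real (A i) \<omega>)" for \<omega>
  have ind: "integrable M (indicat_real B)" for B
    by (rule measure_pmf.integrable_const_bound[where B = 1]) auto
  have int1: "integrable M X" unfolding X_def by (intro Bochner_Integration.integrable_sum ind)
  have X2: "(X \<omega>)\<^sup>2 = (\<Sum>i\<in>I. \<Sum>j\<in>I. indicat_real (A i \<inter> A j) \<omega>)" for \<omega>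
    unfolding X_def power2_eq_square sum_product by (simp add: indicator_inter_arith)
  have int2: "integrable M (\<lambda>\<omega>. (X \<omega>)\<^sup>2)"
    unfolding X2 by (intro Bochner_Integration.integrable_sum ind)
  have E1: "measure_pmf.expectation M X = \<mu>"
    unfolding X_def \<mu>_def by (subst Bochner_Integration.integral_sum[OF ind]) auto
  have E2: "measure_pmf.expectation M (\<lambda>\<omega>. (X \<omega>)\<^sup>2) = (\<Sum>i\<in>I. \<Sum>j\<in>I. measure_pmf.prob M (A i \<inter> A j))"
    unfolding X2
    by (subst Bochner_Integration.integral_sum, intro Bochner_Integration.integrable_sum ind,
        rule sum.cong[OF refl], subst Bochner_Integration.integral_sum[OF ind]) auto
  have eq: "(X \<omega> - \<mu>)\<^sup>2 = (X \<omega>)\<^sup>2 - 2 * \<mu> * X \<omega> + \<mu>\<^sup>2" for \<omega>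
    by (simp add: power2_eq_square algebra_simps)
  have "(1 - measure_pmf.prob M (\<Union>i\<in>I. A i)) * \<mu>\<^sup>2
      = measure_pmf.expectation M (\<lambda>\<omega>. \<mu>\<^sup>2 * indicat_real (- (\<Union>i\<in>I. A i)) \<omega>)"
    using ind measure_pmf.prob_compl[of "\<Union>i\<in>I. A i" M] by (simp add: Compl_eq_Diff_UNIV)
  also have "\<dots> \<le> measure_pmf.expectation M (\<lambda>\<omega>. (X \<omega> - \<mu>)\<^sup>2)"
  proof (rule integral_mono)
    show "integrable M (\<lambda>\<omega>. (X \<omega> - \<mu>)\<^sup>2)" unfolding eq using int1 int2 by auto
    fix \<omega>
    show "\<mu>\<^sup>2 * indicat_real (- (\<Union>i\<in>I. A i)) \<omega> \<le> (X \<omega> - \<mu>)\<^sup>2"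
    proof (cases "\<omega> \<in> (\<Union>i\<in>I. A i)")
      case False
      hence "X \<omega> = 0" unfolding X_def by (intro sum.neutral) auto
      thus ?thesis using False by simp
    qed simp
  qed (use ind in auto)
  also have "\<dots> = measure_pmf.expectation M (\<lambda>\<omega>. (X \<omega>)\<^sup>2) - 2 * \<mu> * measure_pmf.expectation M X + \<mu>\<^sup>2"
    unfolding eq using int1 int2 by simp
  finally show ?thesis unfolding E1 E2 by (simp add: power2_eq_square)
qed

lemma prob_edges_on:
  assumes p: "0 < p" "p < 1" and D: "D \<subseteq> all_edges {1..n}" and S: "S \<subseteq> D"
  shows "measure_pmf.prob (binomial_random_graph n p) {G. uedges G \<inter> D = S}
    = (p / (1 - p)) ^ card S * (1 - p) ^ card D"
proof -
  define A where "A = all_edges {1..n}"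
  have finA: "finite A" by (simp add: A_def finite_all_edges)
  have finD: "finite D" "finite S" using D S finA by (auto simp: A_def dest: finite_subset)
  have "measure_pmf.prob (binomial_random_graph n p) {G. uedges G \<inter> D = S}
      = measure_pmf.prob (Pi_pmf A False (\<lambda>_. bernoulli_pmf p))
          (Pi A (\<lambda>e. if e \<in> S then {True} else if e \<in> D then {False} else UNIV))"
    unfolding binomial_random_graph_def measure_map_pmf A_def[symmetric]
  proof (rule arg_cong[where f = "measure_pmf.prob _"], intro set_eqI)
    fix h :: "nat set \<Rightarrow> bool"
    have "{e \<in> A. h e} \<inter> D = S \<longleftrightarrow> (\<forall>e\<in>D. h e \<longleftrightarrow> e \<in> S)"
      using D S unfolding A_def by blast
    also have "\<dots> \<longleftrightarrow> h \<in> Pi A (\<lambda>e. if e \<in> S then {True} else if e \<in> D then {False} else UNIV)"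
      using D S unfolding A_def[symmetric] Pi_def by auto
    finally show "h \<in> (\<lambda>present. ({1..n}, {e \<in> A. present e})) -` {G. uedges G \<inter> D = S} \<longleftrightarrow>
        h \<in> Pi A (\<lambda>e. if e \<in> S then {True} else if e \<in> D then {False} else UNIV)"
      by simp
  qed
  also have "\<dots> = (\<Prod>e\<in>A. measure_pmf.prob (bernoulli_pmf p)
      (if e \<in> S then {True} else if e \<in> D then {False} else UNIV))"
    using finA by (rule measure_Pi_pmf_Pi)
  also have "\<dots> = (\<Prod>e\<in>A. if e \<in> D then (if e \<in> S then p else 1 - p) else 1)"
    using p S by (intro prod.cong) (auto simp: measure_pmf_single)
  also have "\<dots> = (\<Prod>e\<in>D. if e \<in> S then p else 1 - p)"
    using D finA by (intro prod.mono_neutral_cong_right) (auto simp: A_def)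
  also have "\<dots> = p ^ card S * (1 - p) ^ (card D - card S)"
    using S finD by (simp add: prod.If_cases Int_absorb1 Collect_neg_eq Diff_eq[symmetric] card_Diff_subset)
  also have "(1 - p) ^ (card D - card S) = (1 - p) ^ card D / (1 - p) ^ card S"
    using p S finD by (intro power_diff) (auto intro: card_mono)
  finally show ?thesis by (simp add: power_divide)
qed

text \<open>For the graphs in the support of the random graph, all of whose edges are pairs of vertices, this event
  says that \<open>W\<close> induces a tree.\<close>

definition tree_event :: "nat set \<Rightarrow> nat ugraph set" where
  "tree_event W = {G. uedges G \<inter> all_edges W \<in> trees_on W}"

text \<open>The probability that \<open>k\<close> given vertices induce one given tree. Writing it with \<open>p / (1 - p)\<close> avoids
  the subtraction of the \<open>k - 1\<close> tree edges from all \<open>k choose 2\<close> pairs.\<close>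

definition tree_weight :: "real \<Rightarrow> nat \<Rightarrow> real" where
  "tree_weight p k = (p / (1 - p)) ^ (k - 1) * (1 - p) ^ (k choose 2)"

lemma tree_weight_pos: "0 < p \<Longrightarrow> p < 1 \<Longrightarrow> 0 < tree_weight p k"
  by (simp add: tree_weight_def)

lemma card_trees_on:
  assumes "finite W" "W \<noteq> {}" "card W = k"
  shows "real (card (trees_on W)) = real k ^ k / real k ^ 2"
proof -
  have "real (card (trees_on W) * card W ^ 2) = real (card W ^ card W)"
    using Cayley_formula[OF assms(1,2)] by simp
  moreover have "real (card W) \<noteq> 0" using assms(1,2) by simp
  ultimately show ?thesis unfolding assms(3)[symmetric] by (simp add: eq_divide_eq)
qed

lemma all_edges_mono: "V \<subseteq> W \<Longrightarrow> all_edges V \<subseteq> all_edges W"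
  by (auto simp: all_edges_def)

lemma prob_tree_event:
  assumes p: "0 < p" "p < 1" and W: "W \<subseteq> {1..n}" "W \<noteq> {}"
  shows "measure_pmf.prob (binomial_random_graph n p) (tree_event W)
    = card (trees_on W) * tree_weight p (card W)"
proof -
  have fin: "finite W" using W by (auto dest: finite_subset)
  have "measure_pmf.prob (binomial_random_graph n p) (tree_event W)
      = (\<Sum>T\<in>trees_on W. measure_pmf.prob (binomial_random_graph n p) {G. uedges G \<inter> all_edges W = T})"
    unfolding tree_event_def by (rule prob_in_finite_set[OF finite_trees_on[OF fin]])
  also have "\<dots> = (\<Sum>T\<in>trees_on W. tree_weight p (card W))"
  proof (intro sum.cong refl)
    fix T assume T: "T \<in> trees_on W"
    show "measure_pmf.prob (binomial_random_graph n p) {G. uedges G \<inter> all_edges W = T} = tree_weight p (card W)"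
      using prob_edges_on[OF p all_edges_mono[OF W(1)], of T] T card_tree_edges[OF fin W(2) T]
      by (simp add: trees_on_def tree_weight_def card_all_edges[OF fin])
  qed
  finally show ?thesis by simp
qed

text \<open>Relative to two independent trees, the pairs inside the overlap and the common edges are counted only
  once. This yields the denominator and the weight of a compatible pair.\<close>

lemma prob_tree_event_pair:
  assumes p: "0 < p" "p < 1" and V: "V \<subseteq> {1..n}" and W: "W \<subseteq> {1..n}"
    and card: "card V = k" "card W = k" "k > 0"
  shows "measure_pmf.prob (binomial_random_graph n p) (tree_event V \<inter> tree_event W)
    = (tree_weight p k)\<^sup>2 / (1 - p) ^ (card (V \<inter> W) choose 2)
      * (\<Sum>(S, T)\<in>compatible_trees V W. ((1 - p) / p) ^ card (S \<inter> all_edges W))"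
proof -
  let ?M = "binomial_random_graph n p" and ?q = "1 - p"
  define x where "x = p / ?q"
  have fin: "finite V" "finite W" using V W by (auto dest: finite_subset)
  have ne: "V \<noteq> {}" "W \<noteq> {}" using card by auto
  have q: "?q > 0" "x > 0" using p by (auto simp: x_def)
  have cardD: "card (all_edges V \<union> all_edges W) + (card (V \<inter> W) choose 2) = (k choose 2) + (k choose 2)"
    using card_Un_Int[of "all_edges V" "all_edges W"] fin card
    by (simp add: finite_all_edges card_all_edges all_edges_Int[symmetric])
  have pair: "measure_pmf.prob ?M {G. (uedges G \<inter> all_edges V, uedges G \<inter> all_edges W) = (S, T)}
      = (tree_weight p k)\<^sup>2 / ?q ^ (card (V \<inter> W) choose 2) * (?q / p) ^ card (S \<inter> all_edges W)"
    if ST: "(S, T) \<in> compatible_trees V W" for S T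
  proof -
    have S: "S \<in> trees_on V" "S \<subseteq> all_edges V" and T: "T \<in> trees_on W" "T \<subseteq> all_edges W"
      and comp: "S \<inter> all_edges W = T \<inter> all_edges V"
      using ST by (auto simp: compatible_trees_def trees_on_def)
    have finS: "finite S" "finite T"
      using S(2) T(2) fin by (auto dest: finite_subset simp: finite_all_edges)
    have "S \<inter> T = S \<inter> all_edges W" using S T comp by blast
    hence cardS: "card (S \<union> T) + card (S \<inter> all_edges W) = (k - 1) + (k - 1)"
      using card_Un_Int[of S T] finS card_tree_edges[OF fin(1) ne(1) S(1)]
        card_tree_edges[OF fin(2) ne(2) T(1)] card by simp
    have "{G. (uedges G \<inter> all_edges V, uedges G \<inter> all_edges W) = (S, T)}
        = {G. uedges G \<inter> (all_edges V \<union> all_edges W) = S \<union> T}"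
      using S(2) T(2) comp by auto
    hence "measure_pmf.prob ?M {G. (uedges G \<inter> all_edges V, uedges G \<inter> all_edges W) = (S, T)}
        = x ^ card (S \<union> T) * ?q ^ card (all_edges V \<union> all_edges W)"
      using prob_edges_on[OF p, of "all_edges V \<union> all_edges W" n "S \<union> T"] S(2) T(2)
        all_edges_mono[OF V] all_edges_mono[OF W] by (auto simp: x_def)
    also have "x ^ card (S \<union> T) = x ^ (k - 1) * x ^ (k - 1) / x ^ card (S \<inter> all_edges W)"
      using arg_cong[OF cardS, of "\<lambda>i. x ^ i"] q by (simp add: power_add field_simps)
    also have "?q ^ card (all_edges V \<union> all_edges W)
        = ?q ^ (k choose 2) * ?q ^ (k choose 2) / ?q ^ (card (V \<inter> W) choose 2)"
      using arg_cong[OF cardD, of "\<lambda>i. ?q ^ i"] q by (simp add: power_add field_simps)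
    also have "x ^ (k - 1) * x ^ (k - 1) / x ^ card (S \<inter> all_edges W)
        * (?q ^ (k choose 2) * ?q ^ (k choose 2) / ?q ^ (card (V \<inter> W) choose 2))
      = (tree_weight p k)\<^sup>2 / ?q ^ (card (V \<inter> W) choose 2) * (1 / x) ^ card (S \<inter> all_edges W)"
      by (simp add: tree_weight_def x_def[symmetric] power2_eq_square power_one_over mult_ac)
    finally show ?thesis by (simp add: x_def)
  qed
  have "measure_pmf.prob ?M (tree_event V \<inter> tree_event W)
      = measure_pmf.prob ?M {G. (uedges G \<inter> all_edges V, uedges G \<inter> all_edges W) \<in> compatible_trees V W}"
    unfolding tree_event_def compatible_trees_def
    by (rule arg_cong[where f = "measure_pmf.prob _"]) auto
  also have "\<dots> = (\<Sum>y\<in>compatible_trees V W.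
      measure_pmf.prob ?M {G. (uedges G \<inter> all_edges V, uedges G \<inter> all_edges W) = y})"
    by (rule prob_in_finite_set[OF finite_compatible_trees[OF fin]])
  also have "\<dots> = (\<Sum>(S, T)\<in>compatible_trees V W. (tree_weight p k)\<^sup>2 / ?q ^ (card (V \<inter> W) choose 2)
      * (?q / p) ^ card (S \<inter> all_edges W))"
    using pair by (intro sum.cong refl) (auto simp del: Pair_inject)
  finally show ?thesis by (simp add: sum_distrib_left case_prod_beta)
qed

lemma card_subsets_given_overlap:
  assumes "finite V" "W \<subseteq> V" "card V = n" "card W = k"
  shows "card {U. U \<subseteq> V \<and> card U = m \<and> card (W \<inter> U) = l} \<le> (k choose l) * (n - k choose (m - l))"
proof -
  have fin: "finite W" using assms by (auto dest: finite_subset)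
  let ?B = "{A. A \<subseteq> W \<and> card A = l} \<times> {B. B \<subseteq> V - W \<and> card B = m - l}"
  have "card {U. U \<subseteq> V \<and> card U = m \<and> card (W \<inter> U) = l} \<le> card ?B"
  proof (rule card_inj_on_le[where f = "\<lambda>U. (W \<inter> U, U - W)"])
    show "inj_on (\<lambda>U. (W \<inter> U, U - W)) {U. U \<subseteq> V \<and> card U = m \<and> card (W \<inter> U) = l}"
      by (rule inj_onI) blast
    show "(\<lambda>U. (W \<inter> U, U - W)) ` {U. U \<subseteq> V \<and> card U = m \<and> card (W \<inter> U) = l} \<subseteq> ?B"
      using fin by (auto simp: card_Diff_subset_Int Int_commute)
    show "finite ?B" using assms fin by auto
  qed
  also have "\<dots> = (k choose l) * (n - k choose (m - l))"
    using assms fin n_subsets[OF fin, of l] n_subsets[of "V - W" "m - l"]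
    by (simp add: card_cartesian_product card_Diff_subset)
  finally show ?thesis .
qed

text \<open>The second moment is grouped by the overlap of the two vertex sets. The disjoint pairs contribute at most
  the squared mean, which Chebyshev's inequality subtracts; each other overlap \<open>l\<close> contributes its
  hypergeometric probability times the correlation factor \<open>g l\<close>.\<close>

lemma no_induced_tree_le_overlap_sum:
  fixes g :: "nat \<Rightarrow> real"
  assumes p: "0 < p" "p < 1" and k: "0 < k" "k \<le> n"
  defines "t \<equiv> real k ^ k / real k ^ 2 * tree_weight p k"
  assumes g: "\<And>V W. V \<subseteq> {1..n} \<Longrightarrow> W \<subseteq> {1..n} \<Longrightarrow> card V = k \<Longrightarrow> card W = k \<Longrightarrow>
      measure_pmf.prob (binomial_random_graph n p) (tree_event V \<inter> tree_event W) \<le> t\<^sup>2 * g (card (V \<inter> W))"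
    and g0: "g 0 \<le> 1" and gpos: "\<And>l. g l \<ge> 0"
  shows "1 - measure_pmf.prob (binomial_random_graph n p) (\<Union>W\<in>{W. W \<subseteq> {1..n} \<and> card W = k}. tree_event W)
    \<le> (\<Sum>l\<in>{1..k}. real (k choose l) * real (n - k choose (k - l)) / real (n choose k) * g l)"
proof -
  let ?M = "binomial_random_graph n p"
  define I where "I = {W. W \<subseteq> {1..n} \<and> card W = k}"
  have finI: "finite I" unfolding I_def by (rule finite_subset[of _ "Pow {1..n}"]) auto
  have cardI: "card I = n choose k" unfolding I_def using n_subsets[of "{1..n}" k] by simp
  have Npos: "real (n choose k) > 0" using k by simp
  have tpos: "t > 0" unfolding t_def using k tree_weight_pos[OF p, of k] by simp
  have "(\<Sum>W\<in>I. measure_pmf.prob ?M (tree_event W)) = (\<Sum>W\<in>I. t)"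
  proof (intro sum.cong refl)
    fix W assume "W \<in> I"
    hence W: "W \<subseteq> {1..n}" "card W = k" "W \<noteq> {}" using k by (auto simp: I_def)
    moreover have "finite W" using W by (auto dest: finite_subset)
    ultimately show "measure_pmf.prob ?M (tree_event W) = t"
      using prob_tree_event[OF p W(1,3)] card_trees_on[of W k] by (simp add: t_def)
  qed
  hence mu: "(\<Sum>W\<in>I. measure_pmf.prob ?M (tree_event W)) = real (n choose k) * t" by (simp add: cardI)
  define c where "c l = real (k choose l) * real (n - k choose (k - l))" for l
  have inner: "(\<Sum>W\<in>I. measure_pmf.prob ?M (tree_event V \<inter> tree_event W)) \<le> (\<Sum>l\<le>k. c l * (t\<^sup>2 * g l))"
    if V: "V \<in> I" for V
  proof -
    have V': "V \<subseteq> {1..n}" "card V = k" "finite V" using V by (auto simp: I_def dest: finite_subset)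
    have "(\<Sum>W\<in>I. measure_pmf.prob ?M (tree_event V \<inter> tree_event W)) \<le> (\<Sum>W\<in>I. t\<^sup>2 * g (card (V \<inter> W)))"
      using V by (intro sum_mono g) (auto simp: I_def)
    also have "\<dots> = (\<Sum>l\<le>k. \<Sum>W\<in>{W \<in> I. card (V \<inter> W) = l}. t\<^sup>2 * g (card (V \<inter> W)))"
      using finI V' by (intro sum.group[symmetric]) (auto intro!: card_mono)
    also have "\<dots> = (\<Sum>l\<le>k. card {W \<in> I. card (V \<inter> W) = l} * (t\<^sup>2 * g l))" by simp
    also have "\<dots> \<le> (\<Sum>l\<le>k. c l * (t\<^sup>2 * g l))"
    proof (intro sum_mono mult_right_mono)
      fix l
      have "{W \<in> I. card (V \<inter> W) = l} = {U. U \<subseteq> {1..n} \<and> card U = k \<and> card (V \<inter> U) = l}"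
        by (auto simp: I_def)
      thus "real (card {W \<in> I. card (V \<inter> W) = l}) \<le> c l"
        using card_subsets_given_overlap[of "{1..n}" V n k k l] V'
        unfolding c_def of_nat_mult[symmetric] by (intro of_nat_mono) simp
    qed (use gpos in auto)
    finally show ?thesis .
  qed
  have split: "(\<Sum>l\<le>k. c l * (t\<^sup>2 * g l)) \<le> t\<^sup>2 * real (n choose k) + t\<^sup>2 * (\<Sum>l\<in>{1..k}. c l * g l)"
  proof -
    have "{..k} = insert 0 {1..k}" by auto
    hence "(\<Sum>l\<le>k. c l * (t\<^sup>2 * g l)) = t\<^sup>2 * (c 0 * g 0) + t\<^sup>2 * (\<Sum>l\<in>{1..k}. c l * g l)"
      by (simp add: sum_distrib_left mult_ac)
    moreover have "c 0 * g 0 \<le> c 0 * 1" using g0 by (intro mult_left_mono) (auto simp: c_def)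
    moreover have "c 0 \<le> real (n choose k)" by (auto simp: c_def intro!: binomial_right_mono)
    ultimately show ?thesis using tpos by (auto intro!: mult_left_mono)
  qed
  have "(1 - measure_pmf.prob ?M (\<Union>W\<in>I. tree_event W)) * (real (n choose k) * t)\<^sup>2
      \<le> (\<Sum>V\<in>I. \<Sum>W\<in>I. measure_pmf.prob ?M (tree_event V \<inter> tree_event W)) - (real (n choose k) * t)\<^sup>2"
    using second_moment_bound[OF finI, of ?M tree_event] unfolding mu .
  also have "\<dots> \<le> (\<Sum>V\<in>I. t\<^sup>2 * real (n choose k) + t\<^sup>2 * (\<Sum>l\<in>{1..k}. c l * g l)) - (real (n choose k) * t)\<^sup>2"
    using inner split by (intro diff_right_mono sum_mono) (meson order_trans)
  also have "\<dots> = (\<Sum>l\<in>{1..k}. c l / real (n choose k) * g l) * (real (n choose k) * t)\<^sup>2"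
  proof -
    have "(\<Sum>l\<in>{1..k}. c l / real (n choose k) * g l) = (\<Sum>l\<in>{1..k}. c l * g l) / real (n choose k)"
      by (simp add: sum_divide_distrib)
    thus ?thesis using Npos by (simp add: cardI power2_eq_square field_simps)
  qed
  finally have "1 - measure_pmf.prob ?M (\<Union>W\<in>I. tree_event W) \<le> (\<Sum>l\<in>{1..k}. c l / real (n choose k) * g l)"
    by (rule mult_right_le_imp_le) (use Npos tpos in auto)
  thus ?thesis by (simp add: I_def c_def)
qed

section \<open>Elementary estimates\<close>

lemma partial_exp_le:
  fixes x :: real
  assumes "x \<ge> 0" "finite I"
  shows "(\<Sum>m\<in>I. x ^ m / fact m) \<le> exp x"
proof -
  have "(\<Sum>m\<in>I. x ^ m /\<^sub>R fact m) \<le> (\<Sum>m. x ^ m /\<^sub>R fact m)"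
    using assms by (intro sum_le_suminf summable_exp_generic) auto
  thus ?thesis by (simp add: exp_def field_simps)
qed

lemma power_self_le_exp_fact: "real k ^ k \<le> exp (real k) * fact k"
  using partial_exp_le[of "real k" "{k}"] by (simp add: field_simps)

text \<open>Stirling's upper bound up to a factor of order \<open>sqrt k\<close>. The induction step is the
  inequality \<open>exp 1 \<le> (1 + 1 / k) ^ (k + 1)\<close>.\<close>

lemma fact_le_power_self:
  assumes "k > 0"
  shows "fact k \<le> exp 1 * real k * (real k / exp 1) ^ k"
  using assms
proof (induction k rule: nat_induct_non_zero)
  case (Suc k)
  define x where "x = real k"
  have x: "x > 0" using Suc by (simp add: x_def)
  have "exp 1 \<le> ((x + 1) / x) ^ (k + 1)"
  proof -
    have "ln (x / (x + 1)) \<le> x / (x + 1) - 1" using x by (intro ln_le_minus_one) auto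
    moreover have "x / (x + 1) - 1 = - (1 / (x + 1))" using x by (simp add: field_simps)
    moreover have "ln (x / (x + 1)) = - ln ((x + 1) / x)" using x by (simp add: ln_div)
    ultimately have "1 / (x + 1) \<le> ln ((x + 1) / x)" by linarith
    hence "1 \<le> (x + 1) * ln ((x + 1) / x)" using x by (simp add: field_simps)
    also have "\<dots> = ln (((x + 1) / x) ^ (k + 1))"
      using x by (subst ln_realpow) (auto simp: x_def)
    finally have "exp 1 \<le> exp (ln (((x + 1) / x) ^ (k + 1)))" by simp
    also have "\<dots> = ((x + 1) / x) ^ (k + 1)" using x by (intro exp_ln) simp
    finally show ?thesis .
  qed
  hence "exp 1 * x ^ (k + 1) \<le> (x + 1) ^ (k + 1)" using x by (simp add: power_divide field_simps)
  hence "exp 1 * x ^ (k + 1) / exp 1 ^ k \<le> (x + 1) ^ (k + 1) / exp 1 ^ k"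
    by (rule divide_right_mono) simp
  hence "exp 1 * (x * (x / exp 1) ^ k) \<le> exp 1 * ((x + 1) / exp 1) ^ (k + 1)"
    by (simp add: power_divide)
  hence "(x + 1) * (exp 1 * x * (x / exp 1) ^ k) \<le> (x + 1) * (exp 1 * ((x + 1) / exp 1) ^ (k + 1))"
    using x by (intro mult_left_mono) (auto simp: mult.assoc)
  moreover have "fact (Suc k) \<le> (x + 1) * (exp 1 * x * (x / exp 1) ^ k)"
    using Suc.IH x unfolding fact_Suc by (intro mult_mono) (auto simp: x_def)
  ultimately show ?case by (simp add: x_def mult_ac add.commute)
qed simp

text \<open>Here the main factor \<open>(k / (exp 1 * n)) ^ k\<close> must be exact, since it is balanced against \<open>k ^ (k - 2)\<close>
  trees; only polynomial factors in \<open>k\<close> may be lost.\<close>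

lemma inverse_binomial_le:
  assumes "0 < k" "2 * k ^ 2 \<le> n"
  shows "1 / real (n choose k) \<le> 2 * exp 1 * real k * (real k / (exp 1 * real n)) ^ k"
proof -
  have "k \<le> k ^ 2" using assms(1) by (simp add: power2_eq_square)
  hence kn: "k \<le> n" using assms(2) by linarith
  have n: "n > 0" using assms kn by simp
  have "1 / 2 \<le> 1 - real k * (real k / real n)"
  proof -
    have "real (2 * k ^ 2) \<le> real n" using assms by (intro of_nat_mono)
    thus ?thesis using n by (simp add: field_simps power2_eq_square)
  qed
  also have "\<dots> \<le> (1 + (- (real k / real n))) ^ k"
    using Bernoulli_inequality[of "- (real k / real n)" k] kn n by (simp add: field_simps)
  finally have "real n ^ k * (1 / 2) \<le> real n ^ k * (1 + (- (real k / real n))) ^ k"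
    by (intro mult_left_mono) auto
  also have "\<dots> = (real n - real k) ^ k"
    using n by (simp add: power_mult_distrib[symmetric] field_simps)
  finally have half: "real n ^ k / 2 \<le> (real n - real k) ^ k" by simp
  have "(\<Prod>i = 0..<k. real n - real k) \<le> (\<Prod>i = 0..<k. real n - real i)"
    using kn by (intro prod_mono) auto
  hence "(real n - real k) ^ k \<le> fact k * real (n choose k)"
    by (simp add: binomial_gbinomial gbinomial_mult_fact)
  hence "real n ^ k / 2 \<le> exp 1 * real k * (real k / exp 1) ^ k * real (n choose k)"
    using half mult_right_mono[OF fact_le_power_self[OF assms(1)], of "real (n choose k)"] by linarith
  moreover have "real (n choose k) > 0" "real n ^ k > 0" using kn n by auto
  ultimately show ?thesis by (simp add: field_simps power_divide power_mult_distrib)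
qed

text \<open>The left-hand side is the probability that a uniformly random \<open>k\<close>-set meets a fixed one in \<open>l\<close> points.
  It is at most \<open>(k choose l)\<^sup>2 / (n choose l)\<close>, by choosing the common points first.\<close>

lemma overlap_ratio_le:
  assumes "0 < l" "l \<le> k" "k \<le> n"
  shows "real (k choose l) * real (n - k choose (k - l)) / real (n choose k) \<le> (real k ^ 3 / real n) ^ l"
proof -
  have pos: "real (n choose k) > 0" "real (n choose l) > 0" using assms by auto
  have "(k choose l) * (n choose k) = (n choose l) * (n - l choose (k - l))"
    using choose_mult[of l k n] assms by (simp add: mult.commute)
  hence eq: "real (k choose l) * real (n choose k) = real (n choose l) * real (n - l choose (k - l))"
    unfolding of_nat_mult[symmetric] by simp
  have "real (k choose l) * real (n - k choose (k - l)) / real (n choose k)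
      \<le> real (k choose l) * real (n - l choose (k - l)) / real (n choose k)"
    using assms by (intro divide_right_mono mult_left_mono) (auto intro: binomial_right_mono)
  also have "\<dots> = real (k choose l) * real (k choose l) / real (n choose l)"
    using eq pos by (simp add: field_simps)
  also have "\<dots> \<le> real k ^ l * real k ^ l / (real n / real l) ^ l"
  proof (intro frac_le mult_mono)
    show "real (k choose l) \<le> real k ^ l"
      using binomial_le_pow[OF assms(2)] by (metis of_nat_mono of_nat_power)
    thus "real (k choose l) \<le> real k ^ l" .
    show "(real n / real l) ^ l \<le> real (n choose l)"
      using assms by (intro binomial_ge_n_over_k_pow_k) auto
  qed (use assms in auto)
  also have "\<dots> = (real k * real k * real l / real n) ^ l"
    by (simp add: power_mult_distrib power_divide)
  also have "\<dots> \<le> (real k ^ 3 / real n) ^ l"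
    using assms by (intro power_mono divide_right_mono) (auto simp: power3_eq_cube intro!: mult_left_mono)
  finally show ?thesis .
qed

text \<open>Each term is at most the square of \<open>z ^ m / fact m\<close>, and a sum of squares of nonnegative numbers is at
  most the square of their sum, here a partial sum of the exponential series.\<close>

lemma sum_binomial_squared_le_exp:
  fixes z :: real
  assumes "z \<ge> 0" "l \<le> k"
  shows "(\<Sum>m\<le>l. (real (l choose m))\<^sup>2 * (z\<^sup>2 / (real k)\<^sup>2) ^ m) \<le> exp (2 * z)"
proof (cases "k = 0")
  case True
  thus ?thesis using assms by simp
next
  case False
  define a where "a m = z ^ m / fact m" for m
  have a: "a m \<ge> 0" for m using assms by (simp add: a_def)
  have "(\<Sum>m\<le>l. (real (l choose m))\<^sup>2 * (z\<^sup>2 / (real k)\<^sup>2) ^ m) \<le> (\<Sum>m\<le>l. a m * a m)"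
  proof (rule sum_mono)
    fix m
    have "real (l choose m) * fact m \<le> real l ^ m"
      using of_nat_mono[OF binomial_fact_pow[of l m], where 'a = real] by simp
    also have "\<dots> \<le> real k ^ m" using assms by (intro power_mono) auto
    finally have "real (l choose m) \<le> real k ^ m / fact m" by (simp add: field_simps)
    hence "(real (l choose m))\<^sup>2 \<le> (real k ^ m / fact m)\<^sup>2" by (rule power_mono) simp
    hence "(real (l choose m))\<^sup>2 * (z\<^sup>2 / (real k)\<^sup>2) ^ m \<le> (real k ^ m / fact m)\<^sup>2 * (z\<^sup>2 / (real k)\<^sup>2) ^ m"
      by (rule mult_right_mono) simp
    also have "\<dots> = a m * a m"
      using False by (simp add: a_def power_divide power_mult[symmetric] power2_eq_square mult.commute
        power_mult_distrib)
    finally show "(real (l choose m))\<^sup>2 * (z\<^sup>2 / (real k)\<^sup>2) ^ m \<le> a m * a m" .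
  qed
  also have "\<dots> \<le> (\<Sum>m\<le>l. a m * (\<Sum>i\<le>l. a i))"
    using a by (intro sum_mono mult_left_mono member_le_sum) auto
  also have "\<dots> = (\<Sum>m\<le>l. a m) * (\<Sum>i\<le>l. a i)" by (simp add: sum_distrib_right)
  also have "\<dots> \<le> exp z * exp z"
    using assms a unfolding a_def by (intro mult_mono partial_exp_le) (auto intro!: sum_nonneg)
  finally show ?thesis by (simp add: exp_add[symmetric])
qed

section \<open>Contributions of the different overlaps\<close>

lemma real_choose_two: "real (l choose 2) = real l * (real l - 1) / 2"
  by (induction l) (auto simp: numeral_2_eq_2 field_simps)

lemma inverse_power_choose_two:
  assumes p: "0 < p" "p < (1::real)"
  shows "1 / (1 - p) ^ (l choose 2) = ((1 / (1 - p)) powr ((real l - 1) / 2)) ^ l"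
proof -
  have b: "1 / (1 - p) > 0" using p by simp
  have "1 / (1 - p) ^ (l choose 2) = (1 / (1 - p)) ^ (l choose 2)" by (simp add: power_one_over)
  also have "\<dots> = (1 / (1 - p)) powr real (l choose 2)" using b by (simp add: powr_realpow)
  also have "\<dots> = ((1 / (1 - p)) powr ((real l - 1) / 2)) ^ l"
    using b by (simp add: powr_realpow[symmetric] powr_powr real_choose_two field_simps)
  finally show ?thesis .
qed

lemma inverse_tree_weight:
  assumes p: "0 < p" "p < (1::real)" and k: "k > 0"
  shows "1 / tree_weight p k = p / (1 - p) * ((1 - p) / p * (1 / (1 - p)) powr ((real k - 1) / 2)) ^ k"
proof -
  have "1 / tree_weight p k = ((1 - p) / p) ^ (k - 1) * (1 / (1 - p) ^ (k choose 2))"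
    by (simp add: tree_weight_def power_divide)
  also have "((1 - p) / p) ^ (k - 1) = p / (1 - p) * ((1 - p) / p) ^ k"
    using p k by (cases k) auto
  finally show ?thesis
    unfolding inverse_power_choose_two[OF p] power_mult_distrib by (simp only: mult.assoc)
qed

text \<open>With \<open>n\<close> at least of order \<open>b powr (k / 2)\<close>, each of the \<open>l\<close> common vertices costs about \<open>1 / n\<close> and gains at
  most \<open>b powr (l / 2)\<close> from the pairs inside the overlap, which is at most \<open>b powr (k / 4)\<close>.\<close>

lemma small_overlap_term_le:
  fixes p Y :: real
  defines "b \<equiv> 1 / (1 - p)"
  assumes p: "0 < p" "p < 1" and l: "0 < l" "2 * l \<le> k" and kn: "2 * k ^ 2 \<le> n"
    and H: "b powr ((real k - 5/2) / 2) \<le> exp 1 * real n * p" and Y: "Y \<ge> 1"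
    and small: "exp 1 * p * Y * real k ^ 3 * b powr (5/4 - real k / 4) \<le> 1"
  shows "real (k choose l) * real (n - k choose (k - l)) / real (n choose k) * (Y ^ l / (1 - p) ^ (l choose 2))
    \<le> exp 1 * p * Y * real k ^ 3 * b powr (5/4 - real k / 4)"
proof -
  define \<alpha> where "\<alpha> = exp 1 * p * Y * real k ^ 3 * b powr (5/4 - real k / 4)"
  have b: "b > 1" using p by (simp add: b_def)
  have k: "k > 0" "l \<le> k" using l by auto
  have "k \<le> k ^ 2" using k by (simp add: power2_eq_square)
  hence kn': "k \<le> n" "n > 0" using kn k by linarith+
  have n: "1 / real n \<le> exp 1 * p * b powr (- ((real k - 5/2) / 2))"
    using H kn' b by (simp add: powr_minus field_simps)
  have "real (k choose l) * real (n - k choose (k - l)) / real (n choose k) * (Y ^ l / (1 - p) ^ (l choose 2))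
      \<le> (real k ^ 3 / real n) ^ l * (Y ^ l * (1 / (1 - p) ^ (l choose 2)))"
    using mult_right_mono[OF overlap_ratio_le[OF l(1) k(2) kn'(1)], of "Y ^ l * (1 / (1 - p) ^ (l choose 2))"] Y p
    by simp
  also have "\<dots> = (real k ^ 3 / real n * Y * b powr ((real l - 1) / 2)) ^ l"
    unfolding inverse_power_choose_two[OF p] b_def by (simp add: power_mult_distrib power_divide)
  also have "\<dots> \<le> \<alpha> ^ l"
  proof (rule power_mono)
    have "b powr ((real l - 1) / 2) \<le> b powr (real k / 4)"
      using b l by (intro powr_mono) auto
    hence "real k ^ 3 * (1 / real n) * Y * b powr ((real l - 1) / 2)
      \<le> real k ^ 3 * (exp 1 * p * b powr (- ((real k - 5/2) / 2))) * Y * b powr (real k / 4)"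
      using n Y p by (intro mult_mono) auto
    also have "\<dots> = exp 1 * p * Y * real k ^ 3 * (b powr (- ((real k - 5/2) / 2)) * b powr (real k / 4))"
      by simp
    also have "b powr (- ((real k - 5/2) / 2)) * b powr (real k / 4) = b powr (5/4 - real k / 4)"
      unfolding powr_add[symmetric] by (rule arg_cong[where f = "\<lambda>x. b powr x"]) (simp add: field_simps)
    finally show "real k ^ 3 / real n * Y * b powr ((real l - 1) / 2) \<le> \<alpha>" by (simp add: \<alpha>_def)
    show "0 \<le> real k ^ 3 / real n * Y * b powr ((real l - 1) / 2)" using Y by simp
  qed
  also have "\<dots> \<le> \<alpha> ^ 1"
    using l small Y p by (intro power_decreasing) (auto simp: \<alpha>_def)
  finally show ?thesis by (simp add: \<alpha>_def)
qed

text \<open>The left-hand side is the inverse of the expected number of induced trees of size \<open>k\<close>. The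
  hypothesis is the choice of \<open>k\<close>: at the exponent \<open>(k - 3) / 2\<close> the expectation would be
  of polynomial order, so the margin of \<open>1 / 4\<close> makes it grow exponentially in \<open>k\<close>.\<close>

lemma full_overlap_term_le:
  fixes p :: real
  defines "b \<equiv> 1 / (1 - p)"
  assumes p: "0 < p" "p < 1" and k: "0 < k" and kn: "2 * k ^ 2 \<le> n"
    and H: "b powr ((real k - 5/2) / 2) \<le> exp 1 * real n * p"
  shows "1 / real (n choose k) * (1 / (real k ^ k / real k ^ 2 * tree_weight p k))
    \<le> 2 * exp 1 * p / (1 - p) * real k ^ 3 * b powr (- real k / 4)"
proof -
  have b: "b > 1" using p by (simp add: b_def)
  have "k \<le> k ^ 2" using k by (simp add: power2_eq_square)
  hence kn': "k \<le> n" "n > 0" using kn k by linarith+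
  define B where "B = (1 - p) / p * b powr ((real k - 1) / 2)"
  have B: "B \<ge> 0" using p by (simp add: B_def)
  have "1 / (real k ^ k / real k ^ 2 * tree_weight p k)
      = real k ^ 2 / real k ^ k * (1 / tree_weight p k)" by simp
  also have "\<dots> = real k ^ 2 / real k ^ k * (p / (1 - p) * B ^ k)"
    unfolding inverse_tree_weight[OF p k] B_def b_def by simp
  finally have eq: "1 / (real k ^ k / real k ^ 2 * tree_weight p k)
    = real k ^ 2 / real k ^ k * (p / (1 - p) * B ^ k)" .
  have "1 / real (n choose k) * (1 / (real k ^ k / real k ^ 2 * tree_weight p k))
      \<le> (2 * exp 1 * real k * (real k / (exp 1 * real n)) ^ k) * (real k ^ 2 / real k ^ k * (p / (1 - p) * B ^ k))"
    unfolding eq using inverse_binomial_le[OF k kn] B p by (intro mult_right_mono) auto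
  also have "\<dots> = 2 * exp 1 * p / (1 - p) * real k ^ 3 * (B / (exp 1 * real n)) ^ k"
    using k by (simp add: power_divide power3_eq_cube power2_eq_square mult_ac)
  also have "\<dots> \<le> 2 * exp 1 * p / (1 - p) * real k ^ 3 * (b powr (- 1 / 4)) ^ k"
  proof (intro mult_left_mono power_mono)
    have "B / (exp 1 * real n) = b powr ((real k - 1) / 2) * (1 - p) / (exp 1 * real n * p)"
      by (simp add: B_def mult_ac)
    also have "1 - p = b powr (-1)" using p by (simp add: b_def powr_minus)
    also have "b powr ((real k - 1) / 2) * b powr (- 1) / (exp 1 * real n * p)
        \<le> b powr ((real k - 1) / 2) * b powr (- 1) / b powr ((real k - 5/2) / 2)"
      using H b by (intro divide_left_mono) (auto intro!: mult_pos_pos simp: p kn')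
    also have "\<dots> = b powr ((real k - 1) / 2 + (- 1) - (real k - 5/2) / 2)"
      by (simp only: powr_add powr_diff)
    also have "(real k - 1) / 2 + (- 1) - (real k - 5/2) / 2 = - 1 / 4" by (simp add: field_simps)
    finally show "B / (exp 1 * real n) \<le> b powr (- 1 / 4)" .
  qed (use B p in auto)
  also have "(b powr (- 1 / 4)) ^ k = b powr (- real k / 4)"
    using b by (simp add: powr_realpow[symmetric] powr_powr)
  finally show ?thesis .
qed

text \<open>Compared with two independent trees, the \<open>l\<close> common vertices lose a factor \<open>n ^ l\<close> of choices, and
  the pairs inside the overlap gain \<open>b powr (l * (l - 1) / 2)\<close>. As \<open>n\<close> is at least of
  order \<open>b powr (k / 2)\<close> with the right constant, this leaves \<open>b powr (- j * l / 2)\<close> up to a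
  polynomial factor for each of the \<open>j\<close> remaining vertices. The number of ways to distribute the components
  is bounded by \<open>exp (2 * j * sqrt (k * p / (1 - p)))\<close>, which is subexponential in \<open>k\<close> for each \<open>j\<close>.\<close>

lemma large_overlap_term_le:
  fixes p :: real
  defines "b \<equiv> 1 / (1 - p)"
  assumes p: "0 < p" "p < 1" and kj: "k = l + j" "0 < j" "j \<le> l" and kn: "2 * k ^ 2 \<le> n"
    and H: "b powr ((real k - 5/2) / 2) \<le> exp 1 * real n * p"
    and small: "real k ^ 2 * exp (2 * sqrt (real k * (p / (1 - p)))) * b powr (- real k / 4) \<le> 1"
  shows "real (k choose l) * real (n - k choose (k - l)) / real (n choose k)
      * (1 / ((real k ^ k / real k ^ 2)\<^sup>2 * (1 - p) ^ (l choose 2))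
         * (\<Sum>m\<le>l. (real (l choose m))\<^sup>2
           * (((1 - p) / p) ^ (l - m) * (real l ^ (l - m) * real j ^ (2 * m) * real k ^ (2 * j)))))
    \<le> 2 * exp 1 * real k ^ 7 * exp (2 * sqrt (real k * (p / (1 - p)))) * b powr (- real k / 4)"
proof -
  have b: "b > 1" using p by (simp add: b_def)
  have k: "k > 0" using kj by simp
  have "k \<le> k ^ 2" using k by (simp add: power2_eq_square)
  hence kn': "2 * k \<le> n" "n > 0" using kn k by linarith+
  define y where "y = (1 - p) / p"
  have y: "y > 0" using p by (simp add: y_def)
  define s where "s = sqrt (real k / y)"
  have s: "s = sqrt (real k * (p / (1 - p)))" by (simp add: s_def y_def)
  define B where "B = b powr ((real l - 1) / 2)"
  have B: "B > 0" using b by (simp add: B_def)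
  define \<gamma> where "\<gamma> = real k ^ 2 * exp (2 * s) * b powr (- real k / 4)"
  have ratio: "real (k choose l) * real (n - k choose (k - l)) / real (n choose k)
      \<le> (real k * real n) ^ j * (2 * exp 1 * real k * (real k / (exp 1 * real n)) ^ k)"
  proof -
    have "k choose l = k choose j" using kj by (metis add_diff_cancel_left' binomial_symmetric le_add1)
    also have "\<dots> \<le> k ^ j" using kj by (intro binomial_le_pow) auto
    finally have 1: "real (k choose l) \<le> real k ^ j" by (metis of_nat_mono of_nat_power)
    have "n - k choose (k - l) = n - k choose j" using kj by simp
    also have "\<dots> \<le> (n - k) ^ j" using kj kn' by (intro binomial_le_pow) auto
    also have "\<dots> \<le> n ^ j" by (intro power_mono) auto
    finally have 2: "real (n - k choose (k - l)) \<le> real n ^ j" by (metis of_nat_mono of_nat_power)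
    have "real (k choose l) * real (n - k choose (k - l)) * (1 / real (n choose k))
        \<le> real k ^ j * real n ^ j * (2 * exp 1 * real k * (real k / (exp 1 * real n)) ^ k)"
      using 1 2 inverse_binomial_le[OF k kn] by (intro mult_mono) auto
    thus ?thesis by (simp add: power_mult_distrib)
  qed
  have sum: "(\<Sum>m\<le>l. (real (l choose m))\<^sup>2
           * (y ^ (l - m) * (real l ^ (l - m) * real j ^ (2 * m) * real k ^ (2 * j))))
      \<le> y ^ l * real k ^ l * real k ^ (2 * j) * exp (2 * s) ^ j"
  proof -
    have "(\<Sum>m\<le>l. (real (l choose m))\<^sup>2
           * (y ^ (l - m) * (real l ^ (l - m) * real j ^ (2 * m) * real k ^ (2 * j))))
        \<le> (\<Sum>m\<le>l. y ^ l * real k ^ l * real k ^ (2 * j)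
             * ((real (l choose m))\<^sup>2 * ((real j * s)\<^sup>2 / (real k)\<^sup>2) ^ m))"
    proof (rule sum_mono)
      fix m assume "m \<in> {..l}"
      hence m: "m \<le> l" by simp
      have "(real j * s)\<^sup>2 / (real k)\<^sup>2 = real j ^ 2 / (y * real k)"
        using y k unfolding s_def power_mult_distrib by (simp add: power2_eq_square)
      hence "((real j * s)\<^sup>2 / (real k)\<^sup>2) ^ m = real j ^ (2 * m) / (y ^ m * real k ^ m)"
        by (simp add: power_divide power_mult_distrib power_mult)
      moreover have "y ^ (l - m) = y ^ l / y ^ m" "real k ^ (l - m) = real k ^ l / real k ^ m"
        using y k m by (auto intro!: power_diff)
      moreover have "real l ^ (l - m) \<le> real k ^ (l - m)" using kj by (intro power_mono) auto
      hence "(real (l choose m))\<^sup>2 * (y ^ (l - m) * (real l ^ (l - m) * real j ^ (2 * m) * real k ^ (2 * j)))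
        \<le> (real (l choose m))\<^sup>2 * (y ^ (l - m) * (real k ^ (l - m) * real j ^ (2 * m) * real k ^ (2 * j)))"
        using y by (intro mult_left_mono mult_right_mono) auto
      ultimately show "(real (l choose m))\<^sup>2 * (y ^ (l - m) * (real l ^ (l - m) * real j ^ (2 * m) * real k ^ (2 * j)))
        \<le> y ^ l * real k ^ l * real k ^ (2 * j)
             * ((real (l choose m))\<^sup>2 * ((real j * s)\<^sup>2 / (real k)\<^sup>2) ^ m)"
        by (simp add: mult_ac)
    qed
    also have "\<dots> = y ^ l * real k ^ l * real k ^ (2 * j)
             * (\<Sum>m\<le>l. (real (l choose m))\<^sup>2 * ((real j * s)\<^sup>2 / (real k)\<^sup>2) ^ m)"
      by (rule sum_distrib_left[symmetric])
    also have "\<dots> \<le> y ^ l * real k ^ l * real k ^ (2 * j) * exp (2 * (real j * s))"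
      using y kj by (intro mult_left_mono sum_binomial_squared_le_exp) (auto simp: s_def)
    also have "exp (2 * (real j * s)) = exp (2 * s) ^ j"
      by (simp add: exp_of_nat_mult[symmetric] mult_ac)
    finally show ?thesis .
  qed
  have Beq: "1 / (1 - p) ^ (l choose 2) = B ^ l"
    unfolding inverse_power_choose_two[OF p] B_def b_def ..
  have "1 / ((real k ^ k / real k ^ 2)\<^sup>2 * (1 - p) ^ (l choose 2))
      = (real k ^ 2 / real k ^ k)\<^sup>2 * (1 / (1 - p) ^ (l choose 2))"
    using k p by (simp add: field_simps)
  hence tau: "1 / ((real k ^ k / real k ^ 2)\<^sup>2 * (1 - p) ^ (l choose 2)) = (real k ^ 2 / real k ^ k)\<^sup>2 * B ^ l"
    unfolding Beq .
  have "real (k choose l) * real (n - k choose (k - l)) / real (n choose k)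
      * (1 / ((real k ^ k / real k ^ 2)\<^sup>2 * (1 - p) ^ (l choose 2))
         * (\<Sum>m\<le>l. (real (l choose m))\<^sup>2
           * (y ^ (l - m) * (real l ^ (l - m) * real j ^ (2 * m) * real k ^ (2 * j)))))
    \<le> ((real k * real n) ^ j * (2 * exp 1 * real k * (real k / (exp 1 * real n)) ^ k))
      * ((real k ^ 2 / real k ^ k)\<^sup>2 * B ^ l * (y ^ l * real k ^ l * real k ^ (2 * j) * exp (2 * s) ^ j))"
    unfolding tau using ratio sum y B
    by (intro mult_mono mult_left_mono) (auto intro!: sum_nonneg mult_nonneg_nonneg)
  also have "\<dots> = 2 * exp 1 * real k ^ 5 * (real k ^ 2 * exp (2 * s)) ^ j * (y * B / (exp 1 * real n)) ^ l / exp 1 ^ j"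
  proof -
    define u v w where "u = real k" and "v = real n" and "w = (exp 1 :: real)"
    have nz: "u \<noteq> 0" "v \<noteq> 0" "w \<noteq> 0" using k kn' by (auto simp: u_def v_def w_def)
    have "((u * v) ^ j * (2 * w * u * (u / (w * v)) ^ k)) * ((u ^ 2 / u ^ k)\<^sup>2 * B ^ l * (y ^ l * u ^ l * u ^ (2 * j) * E))
      = 2 * w * u ^ 5 * ((u ^ 2) ^ j * E) * (y * B / (w * v)) ^ l / w ^ j" for E
      unfolding kj(1) power_add power_mult_distrib power_divide
      using nz by (simp add: field_simps power_mult[symmetric] power_add[symmetric] eval_nat_numeral)
    from this[of "exp (2 * s) ^ j"] show ?thesis
      by (simp only: u_def v_def w_def power_mult_distrib)
  qed
  also have "\<dots> \<le> 2 * exp 1 * real k ^ 5 * (real k ^ 2 * exp (2 * s)) ^ j * (y * B / (exp 1 * real n)) ^ l / 1"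
    using y B by (intro divide_left_mono) (auto intro!: mult_nonneg_nonneg one_le_power)
  also have "\<dots> = 2 * exp 1 * real k ^ 5 * (real k ^ 2 * exp (2 * s)) ^ j * (y * B / (exp 1 * real n)) ^ l" by simp
  also have "\<dots> \<le> 2 * exp 1 * real k ^ 5 * (real k ^ 2 * exp (2 * s)) ^ j * (b powr (- real k / 4)) ^ j"
  proof (intro mult_left_mono)
    have "y * B / (exp 1 * real n) = B * (1 - p) / (exp 1 * real n * p)"
      by (simp add: y_def mult_ac)
    also have "1 - p = b powr (-1)" using p by (simp add: b_def powr_minus)
    also have "B * b powr (- 1) / (exp 1 * real n * p) \<le> B * b powr (- 1) / b powr ((real k - 5/2) / 2)"
      using H b B by (intro divide_left_mono) (auto intro!: mult_pos_pos simp: p kn')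
    also have "\<dots> = b powr ((real l - 1) / 2 + (- 1) - (real k - 5/2) / 2)"
      by (simp only: powr_add powr_diff B_def)
    also have "\<dots> \<le> b powr (- real j / 2)"
      using b kj by (intro powr_mono) (auto simp: field_simps)
    finally have "y * B / (exp 1 * real n) \<le> b powr (- real j / 2)" .
    hence "(y * B / (exp 1 * real n)) ^ l \<le> (b powr (- real j / 2)) ^ l"
      using y B by (intro power_mono) auto
    also have "\<dots> = b powr (- real j / 2 * real l)"
      using b by (simp add: powr_realpow[symmetric] powr_powr)
    also have "\<dots> \<le> b powr (- real k / 4 * real j)"
    proof (rule powr_mono)
      have "real k / 4 * real j \<le> real l / 2 * real j"
        using kj by (intro mult_right_mono) auto
      thus "- real j / 2 * real l \<le> - real k / 4 * real j" by (simp add: mult_ac)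
    qed (use b in auto)
    also have "\<dots> = (b powr (- real k / 4)) ^ j"
      using b by (simp add: powr_realpow[symmetric] powr_powr)
    finally show "(y * B / (exp 1 * real n)) ^ l \<le> (b powr (- real k / 4)) ^ j" .
  qed auto
  also have "\<dots> = 2 * exp 1 * real k ^ 5 * \<gamma> ^ j" by (simp add: \<gamma>_def power_mult_distrib)
  also have "\<dots> \<le> 2 * exp 1 * real k ^ 5 * \<gamma> ^ 1"
    using small kj by (intro mult_left_mono power_decreasing) (auto simp: \<gamma>_def s)
  also have "\<dots> = 2 * exp 1 * real k ^ 7 * exp (2 * s) * b powr (- real k / 4)"
    by (simp add: \<gamma>_def eval_nat_numeral)
  finally show ?thesis by (simp only: y_def s)
qed

section \<open>Existence of an induced tree of the threshold size\<close>

text \<open>The factor by which the probability that two given vertex sets of size \<open>k\<close> with \<open>l\<close> common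
  elements both induce trees may exceed the squared probability for one set. The overlaps are split at
  half the size: below, the trivial count of pairs suffices; above, the refined one is small enough.\<close>

definition overlap_factor :: "real \<Rightarrow> nat \<Rightarrow> nat \<Rightarrow> real" where
  "overlap_factor p k l =
    (if l = k then 1 / (real k ^ k / real k ^ 2 * tree_weight p k)
     else if 2 * l \<le> k then max 1 ((1 - p) / p) ^ l / (1 - p) ^ (l choose 2)
     else 1 / ((real k ^ k / real k ^ 2)\<^sup>2 * (1 - p) ^ (l choose 2))
       * (\<Sum>m\<le>l. (real (l choose m))\<^sup>2
            * (((1 - p) / p) ^ (l - m) * (real l ^ (l - m) * real (k - l) ^ (2 * m) * real k ^ (2 * (k - l))))))"

lemma overlap_factor_nonneg:
  assumes "0 < p" "p < 1"
  shows "overlap_factor p k l \<ge> 0"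
  using assms tree_weight_pos[OF assms, of k]
  by (auto simp: overlap_factor_def intro!: mult_nonneg_nonneg sum_nonneg divide_nonneg_nonneg)

lemma prob_pair_le_overlap_factor:
  assumes p: "0 < p" "p < 1" and k: "0 < k"
    and V: "V \<subseteq> {1..n}" "card V = k" and W: "W \<subseteq> {1..n}" "card W = k"
  shows "measure_pmf.prob (binomial_random_graph n p) (tree_event V \<inter> tree_event W)
    \<le> (real k ^ k / real k ^ 2 * tree_weight p k)\<^sup>2 * overlap_factor p k (card (V \<inter> W))"
proof -
  define l where "l = card (V \<inter> W)"
  define \<tau> where "\<tau> = real k ^ k / real k ^ 2"
  have fin: "finite V" "finite W" using V W by (auto dest: finite_subset)
  have ne: "V \<noteq> {}" "W \<noteq> {}" using V W k by auto
  have tau: "real (card (trees_on V)) = \<tau>" "real (card (trees_on W)) = \<tau>"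
    using card_trees_on[OF fin(1) ne(1) V(2)] card_trees_on[OF fin(2) ne(2) W(2)] by (auto simp: \<tau>_def)
  have tpos: "\<tau> > 0" using k by (simp add: \<tau>_def)
  have wpos: "tree_weight p k > 0" using tree_weight_pos[OF p] .
  have lk: "l \<le> k" unfolding l_def V(2)[symmetric] using fin by (intro card_mono) auto
  have y: "(1 - p) / p \<ge> 0" using p by simp
  define Z where "Z = (\<Sum>(S, T)\<in>compatible_trees V W. ((1 - p) / p) ^ card (S \<inter> all_edges W))"
  have pair: "measure_pmf.prob (binomial_random_graph n p) (tree_event V \<inter> tree_event W)
      = (tree_weight p k)\<^sup>2 / (1 - p) ^ (l choose 2) * Z"
    unfolding l_def Z_def by (rule prob_tree_event_pair[OF p V(1) W(1) V(2) W(2) k])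
  consider "l = k" | "l < k" "2 * l \<le> k" | "l < k" "2 * l > k" using lk by linarith
  thus ?thesis
  proof cases
    case 1
    hence "V \<inter> W = V" "V \<inter> W = W" using fin V W by (auto simp: l_def card_subset_eq)
    hence "measure_pmf.prob (binomial_random_graph n p) (tree_event V \<inter> tree_event W) = \<tau> * tree_weight p k"
      using prob_tree_event[OF p V(1) ne(1)] tau V(2) by simp
    thus ?thesis
      using 1 tpos wpos unfolding l_def[symmetric] \<tau>_def[symmetric] overlap_factor_def
      by (simp add: power2_eq_square)
  next
    case 2
    hence "V \<inter> W \<noteq> V" using V by (auto simp: l_def)
    hence "Z \<le> \<tau> * \<tau> * max 1 ((1 - p) / p) ^ l"
      using compatible_weight_le_trivial[OF fin _ y] unfolding Z_def tau[symmetric] l_def by (simp add: tau)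
    hence "(tree_weight p k)\<^sup>2 / (1 - p) ^ (l choose 2) * Z
      \<le> (tree_weight p k)\<^sup>2 / (1 - p) ^ (l choose 2) * (\<tau> * \<tau> * max 1 ((1 - p) / p) ^ l)"
      using p by (intro mult_left_mono) auto
    also have "\<dots> = (\<tau> * tree_weight p k)\<^sup>2 * overlap_factor p k l"
      using 2 by (simp add: overlap_factor_def power2_eq_square mult_ac)
    finally show ?thesis unfolding pair \<tau>_def l_def .
  next
    case 3
    define \<Sigma> where "\<Sigma> = (\<Sum>m\<le>l. (real (l choose m))\<^sup>2
            * (((1 - p) / p) ^ (l - m) * (real l ^ (l - m) * real (k - l) ^ (2 * m) * real k ^ (2 * (k - l)))))"
    have "Z \<le> \<Sigma>"
      unfolding Z_def \<Sigma>_def using 3 compatible_weight_le[OF fin V(2) W(2) l_def[symmetric] _ _ y, of "k - l"] by simp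
    hence "(tree_weight p k)\<^sup>2 / (1 - p) ^ (l choose 2) * Z \<le> (tree_weight p k)\<^sup>2 / (1 - p) ^ (l choose 2) * \<Sigma>"
      using p by (intro mult_left_mono) auto
    also have "\<dots> = (\<tau> * tree_weight p k)\<^sup>2 * (1 / (\<tau>\<^sup>2 * (1 - p) ^ (l choose 2)) * \<Sigma>)"
      using tpos by (simp add: power_mult_distrib)
    also have "1 / (\<tau>\<^sup>2 * (1 - p) ^ (l choose 2)) * \<Sigma> = overlap_factor p k l"
      using 3 unfolding overlap_factor_def \<tau>_def \<Sigma>_def by auto
    finally show ?thesis unfolding pair \<tau>_def l_def .
  qed
qed

text \<open>The three summands bound the contributions of an overlap of at most half the size, of a full overlap, and
  of an overlap in between; the factor \<open>k\<close> is the number of possible overlaps.\<close>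

definition no_tree_bound :: "real \<Rightarrow> nat \<Rightarrow> real" where
  "no_tree_bound p k = real k *
     (exp 1 * p * max 1 ((1 - p) / p) * real k ^ 3 * (1 / (1 - p)) powr (5/4 - real k / 4)
      + 2 * exp 1 * p / (1 - p) * real k ^ 3 * (1 / (1 - p)) powr (- real k / 4)
      + 2 * exp 1 * real k ^ 7 * exp (2 * sqrt (real k * (p / (1 - p)))) * (1 / (1 - p)) powr (- real k / 4))"

lemma prob_no_induced_tree_le:
  assumes p: "0 < p" "p < 1" and k: "0 < k" and kn: "2 * k ^ 2 \<le> n"
    and H: "(1 / (1 - p)) powr ((real k - 5/2) / 2) \<le> exp 1 * real n * p"
    and small: "exp 1 * p * max 1 ((1 - p) / p) * real k ^ 3 * (1 / (1 - p)) powr (5/4 - real k / 4) \<le> 1"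
      "real k ^ 2 * exp (2 * sqrt (real k * (p / (1 - p)))) * (1 / (1 - p)) powr (- real k / 4) \<le> 1"
  shows "1 - measure_pmf.prob (binomial_random_graph n p) (\<Union>W\<in>{W. W \<subseteq> {1..n} \<and> card W = k}. tree_event W)
    \<le> no_tree_bound p k"
proof -
  define T1 where "T1 = exp 1 * p * max 1 ((1 - p) / p) * real k ^ 3 * (1 / (1 - p)) powr (5/4 - real k / 4)"
  define T2 where "T2 = 2 * exp 1 * p / (1 - p) * real k ^ 3 * (1 / (1 - p)) powr (- real k / 4)"
  define T3 where "T3 = 2 * exp 1 * real k ^ 7 * exp (2 * sqrt (real k * (p / (1 - p)))) * (1 / (1 - p)) powr (- real k / 4)"
  have nonneg: "T1 \<ge> 0" "T2 \<ge> 0" "T3 \<ge> 0" using p by (auto simp: T1_def T2_def T3_def)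
  have "k \<le> k ^ 2" using k by (simp add: power2_eq_square)
  hence kn': "k \<le> n" using kn by linarith
  have g0: "overlap_factor p k 0 \<le> 1" using k by (simp add: overlap_factor_def numeral_2_eq_2)
  have "1 - measure_pmf.prob (binomial_random_graph n p) (\<Union>W\<in>{W. W \<subseteq> {1..n} \<and> card W = k}. tree_event W)
    \<le> (\<Sum>l\<in>{1..k}. real (k choose l) * real (n - k choose (k - l)) / real (n choose k) * overlap_factor p k l)"
    using prob_pair_le_overlap_factor[OF p k] g0 overlap_factor_nonneg[OF p]
    by (intro no_induced_tree_le_overlap_sum[OF p k kn']) auto
  also have "\<dots> \<le> (\<Sum>l\<in>{1..k}. T1 + T2 + T3)"
  proof (rule sum_mono)
    fix l assume l: "l \<in> {1..k}"
    consider "l = k" | "l < k" "2 * l \<le> k" | "l < k" "2 * l > k" using l by fastforce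
    hence "real (k choose l) * real (n - k choose (k - l)) / real (n choose k) * overlap_factor p k l \<le> T1
      \<or> real (k choose l) * real (n - k choose (k - l)) / real (n choose k) * overlap_factor p k l \<le> T2
      \<or> real (k choose l) * real (n - k choose (k - l)) / real (n choose k) * overlap_factor p k l \<le> T3"
    proof cases
      case 1
      thus ?thesis using full_overlap_term_le[OF p k kn H] by (simp add: overlap_factor_def T2_def)
    next
      case 2
      hence "overlap_factor p k l = max 1 ((1 - p) / p) ^ l / (1 - p) ^ (l choose 2)"
        by (simp add: overlap_factor_def)
      thus ?thesis
        using small_overlap_term_le[OF p _ 2(2) kn H _ small(1)] l by (simp add: T1_def)
    next
      case 3
      have "overlap_factor p k l = 1 / ((real k ^ k / real k ^ 2)\<^sup>2 * (1 - p) ^ (l choose 2))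
        * (\<Sum>m\<le>l. (real (l choose m))\<^sup>2
            * (((1 - p) / p) ^ (l - m) * (real l ^ (l - m) * real (k - l) ^ (2 * m) * real k ^ (2 * (k - l)))))"
        using 3 unfolding overlap_factor_def by auto
      thus ?thesis
        using large_overlap_term_le[OF p _ _ _ kn H small(2), of l "k - l"] 3 by (simp only: T3_def) simp
    qed
    thus "real (k choose l) * real (n - k choose (k - l)) / real (n choose k) * overlap_factor p k l \<le> T1 + T2 + T3"
      using nonneg by linarith
  qed
  also have "\<dots> = no_tree_bound p k" by (simp add: no_tree_bound_def T1_def T2_def T3_def)
  finally show ?thesis .
qed

lemma no_tree_bound_tendsto_0:
  assumes p: "0 < p" "p < 1"
  shows "no_tree_bound p \<longlonglongrightarrow> 0"
    and "\<forall>\<^sub>F k in sequentially. exp 1 * p * max 1 ((1 - p) / p) * real k ^ 3 * (1 / (1 - p)) powr (5/4 - real k / 4) \<le> 1"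
    and "\<forall>\<^sub>F k in sequentially. real k ^ 2 * exp (2 * sqrt (real k * (p / (1 - p)))) * (1 / (1 - p)) powr (- real k / 4) \<le> 1"
proof -
  define b c Y where "b = 1 / (1 - p)" and "c = p / (1 - p)" and "Y = max 1 ((1 - p) / p)"
  have b: "b > 1" and c: "c > 0" and Y: "Y > 0" using p by (auto simp: b_def c_def Y_def)
  show "no_tree_bound p \<longlonglongrightarrow> 0"
    unfolding no_tree_bound_def[abs_def] b_def[symmetric] c_def[symmetric] Y_def[symmetric]
      times_divide_eq_right[symmetric, of _ p]
    using b c Y p by real_asymp
  have "(\<lambda>k. exp 1 * p * Y * real k ^ 3 * b powr (5/4 - real k / 4)) \<longlonglongrightarrow> 0"
    using b Y p by real_asymp
  from order_tendstoD(2)[OF this, of 1]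
  show "\<forall>\<^sub>F k in sequentially. exp 1 * p * max 1 ((1 - p) / p) * real k ^ 3 * (1 / (1 - p)) powr (5/4 - real k / 4) \<le> 1"
    unfolding b_def Y_def by (auto elim: eventually_mono)
  have "(\<lambda>k. real k ^ 2 * exp (2 * sqrt (real k * c)) * b powr (- real k / 4)) \<longlonglongrightarrow> 0"
    using b c by real_asymp
  from order_tendstoD(2)[OF this, of 1]
  show "\<forall>\<^sub>F k in sequentially. real k ^ 2 * exp (2 * sqrt (real k * (p / (1 - p)))) * (1 / (1 - p)) powr (- real k / 4) \<le> 1"
    unfolding b_def c_def by (auto elim: eventually_mono)
qed

section \<open>Absence of larger induced trees\<close>

text \<open>The union bound over all vertex sets and all trees on them. Since \<open>k ^ k / fact k\<close> is at most
  \<open>exp k\<close>, the expected number of trees is at most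
  \<open>(1 - p) / p * (exp 1 * n * p * b powr ((3 - k) / 2)) ^ k\<close>.\<close>

lemma prob_induced_tree_of_size_le:
  fixes p :: real
  defines "b \<equiv> 1 / (1 - p)"
  assumes p: "0 < p" "p < 1" and k: "0 < k"
    and H: "exp 1 * real n * p \<le> b powr ((real k - 7/2) / 2)"
  shows "measure_pmf.prob (binomial_random_graph n p) (\<Union>W\<in>{W. W \<subseteq> {1..n} \<and> card W = k}. tree_event W)
    \<le> (1 - p) / p * (b powr (- 1 / 4)) ^ k"
proof -
  let ?M = "binomial_random_graph n p"
  define I where "I = {W. W \<subseteq> {1..n} \<and> card W = k}"
  have finI: "finite I" unfolding I_def by (rule finite_subset[of _ "Pow {1..n}"]) auto
  have cardI: "card I = n choose k" unfolding I_def using n_subsets[of "{1..n}" k] by simp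
  have b: "b > 1" using p by (simp add: b_def)
  have wpos: "tree_weight p k > 0" using tree_weight_pos[OF p] .
  define B where "B = (1 - p) / p * b powr ((real k - 1) / 2)"
  have B: "B > 0" using p b by (simp add: B_def)
  have "1 / tree_weight p k = p / (1 - p) * B ^ k"
    using inverse_tree_weight[OF p k] by (simp add: B_def b_def)
  hence w: "tree_weight p k = (1 - p) / p * (1 / B ^ k)"
    using wpos B p by (simp add: field_simps)
  have "measure_pmf.prob ?M (\<Union>W\<in>I. tree_event W) \<le> (\<Sum>W\<in>I. measure_pmf.prob ?M (tree_event W))"
    by (rule measure_pmf.finite_measure_subadditive_finite[OF finI]) auto
  also have "\<dots> = (\<Sum>W\<in>I. real k ^ k / real k ^ 2 * tree_weight p k)"
  proof (intro sum.cong refl)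
    fix W assume "W \<in> I"
    hence W: "W \<subseteq> {1..n}" "card W = k" "W \<noteq> {}" "finite W"
      using k by (auto simp: I_def dest: finite_subset)
    show "measure_pmf.prob ?M (tree_event W) = real k ^ k / real k ^ 2 * tree_weight p k"
      using prob_tree_event[OF p W(1,3)] card_trees_on[OF W(4,3,2)] W(2) by simp
  qed
  also have "\<dots> = real (n choose k) * (real k ^ k / real k ^ 2) * tree_weight p k"
    by (simp add: cardI)
  also have "\<dots> \<le> (exp 1 * real n) ^ k * tree_weight p k"
  proof (rule mult_right_mono)
    have "real (n choose k) * (real k ^ k / real k ^ 2) \<le> real (n choose k) * (real k ^ k / 1)"
      using k by (intro mult_left_mono divide_left_mono) auto
    also have "\<dots> \<le> real (n choose k) * (exp (real k) * fact k)"
      using power_self_le_exp_fact[of k] by (intro mult_left_mono) auto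
    also have "\<dots> = exp 1 ^ k * real ((n choose k) * fact k)"
      by (simp add: exp_of_nat_mult[symmetric])
    also have "\<dots> \<le> exp 1 ^ k * real (n ^ k)"
      by (intro mult_left_mono of_nat_mono binomial_fact_pow) auto
    finally show "real (n choose k) * (real k ^ k / real k ^ 2) \<le> (exp 1 * real n) ^ k"
      by (simp add: power_mult_distrib)
  qed (use wpos in auto)
  also have "\<dots> = (1 - p) / p * (exp 1 * real n / B) ^ k"
    by (simp add: w power_divide)
  also have "\<dots> \<le> (1 - p) / p * (b powr (- 1 / 4)) ^ k"
  proof (intro mult_left_mono power_mono)
    have "exp 1 * real n / B = exp 1 * real n * p * (1 / (1 - p)) / b powr ((real k - 1) / 2)"
      using p by (simp add: B_def)
    also have "1 / (1 - p) = b powr 1" using p by (simp add: b_def)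
    also have "exp 1 * real n * p * b powr 1 / b powr ((real k - 1) / 2)
        \<le> b powr ((real k - 7/2) / 2) * b powr 1 / b powr ((real k - 1) / 2)"
      using H by (intro divide_right_mono mult_right_mono) auto
    also have "\<dots> = b powr ((real k - 7/2) / 2 + 1 - (real k - 1) / 2)"
      by (simp only: powr_add powr_diff)
    also have "(real k - 7/2) / 2 + 1 - (real k - 1) / 2 = - 1 / 4" by (simp add: field_simps)
    finally show "exp 1 * real n / B \<le> b powr (- 1 / 4)" .
  qed (use p B in auto)
  finally show ?thesis by (simp add: I_def)
qed

text \<open>Since \<open>(k + 2) - 7/2 = k - 3/2\<close>, the bound for a single size applies from \<open>k + 2\<close> on, and these
  bounds form a geometric series.\<close>

lemma prob_large_induced_tree_le:
  fixes p :: real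
  defines "b \<equiv> 1 / (1 - p)"
  assumes p: "0 < p" "p < 1" and H: "exp 1 * real n * p \<le> b powr ((real k - 3/2) / 2)"
  shows "measure_pmf.prob (binomial_random_graph n p)
      (\<Union>i\<in>{k + 2..n}. \<Union>W\<in>{W. W \<subseteq> {1..n} \<and> card W = i}. tree_event W)
    \<le> (1 - p) / p * ((b powr (- 1 / 4)) ^ k / (1 - b powr (- 1 / 4)))"
proof -
  let ?M = "binomial_random_graph n p"
  define r where "r = b powr (- 1 / 4)"
  have b: "b > 1" using p by (simp add: b_def)
  have r: "0 < r" "r < 1" using b by (auto simp: r_def powr_less_one)
  have "measure_pmf.prob ?M (\<Union>i\<in>{k + 2..n}. \<Union>W\<in>{W. W \<subseteq> {1..n} \<and> card W = i}. tree_event W)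
      \<le> (\<Sum>i\<in>{k + 2..n}. measure_pmf.prob ?M (\<Union>W\<in>{W. W \<subseteq> {1..n} \<and> card W = i}. tree_event W))"
    by (rule measure_pmf.finite_measure_subadditive_finite) auto
  also have "\<dots> \<le> (\<Sum>i\<in>{k + 2..n}. (1 - p) / p * r ^ i)"
  proof (rule sum_mono)
    fix i assume i: "i \<in> {k + 2..n}"
    have "exp 1 * real n * p \<le> b powr ((real k - 3/2) / 2)" by fact
    also have "\<dots> \<le> b powr ((real i - 7/2) / 2)" using b i by (intro powr_mono) auto
    finally show "measure_pmf.prob ?M (\<Union>W\<in>{W. W \<subseteq> {1..n} \<and> card W = i}. tree_event W) \<le> (1 - p) / p * r ^ i"
      unfolding b_def r_def using i by (intro prob_induced_tree_of_size_le p) auto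
  qed
  also have "\<dots> = (1 - p) / p * (\<Sum>i\<in>{k + 2..n}. r ^ i)" by (rule sum_distrib_left[symmetric])
  also have "\<dots> \<le> (1 - p) / p * (r ^ k / (1 - r))"
  proof (rule mult_left_mono)
    have "(\<Sum>i\<in>{k + 2..n}. r ^ i) \<le> r ^ (k + 2) / (1 - r)"
      using r by (simp add: sum_gp divide_right_mono)
    also have "\<dots> \<le> r ^ k / (1 - r)"
      using r by (intro divide_right_mono power_decreasing) auto
    finally show "(\<Sum>i\<in>{k + 2..n}. r ^ i) \<le> r ^ k / (1 - r)" .
  qed (use p in auto)
  finally show ?thesis by (simp add: r_def)
qed

lemma max_induced_tree_size_between:
  assumes G: "G \<in> set_pmf (binomial_random_graph n p)"
    and ex: "G \<in> (\<Union>W\<in>{W. W \<subseteq> {1..n} \<and> card W = k}. tree_event W)"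
    and none: "G \<notin> (\<Union>i\<in>{k + 2..n}. \<Union>W\<in>{W. W \<subseteq> {1..n} \<and> card W = i}. tree_event W)"
  shows "max_induced_tree_size G \<in> {k, k + 1}"
proof -
  have vG: "uverts G = {1..n}" and eG: "uedges G \<subseteq> all_edges {1..n}"
    using G by (auto simp: binomial_random_graph_def)
  have iff: "is_tree (induced_subgraph G W) \<longleftrightarrow> G \<in> tree_event W" if "W \<subseteq> {1..n}" for W
  proof -
    have "{e \<in> uedges G. e \<subseteq> W} = uedges G \<inter> all_edges W"
      using eG by (auto simp: all_edges_def)
    thus ?thesis by (simp add: induced_subgraph_def tree_event_def trees_on_def)
  qed
  define S where "S = {card W |W. W \<subseteq> uverts G \<and> is_tree (induced_subgraph G W)}"
  have S: "S = {card W |W. W \<subseteq> {1..n} \<and> G \<in> tree_event W}"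
    unfolding S_def vG using iff by blast
  have "S \<subseteq> {..n}"
  proof
    fix i assume "i \<in> S"
    then obtain W where "W \<subseteq> {1..n}" "i = card W" by (auto simp: S)
    thus "i \<in> {..n}" using card_mono[of "{1..n}" W] by simp
  qed
  hence fin: "finite S" by (rule finite_subset) simp
  have kS: "k \<in> S" using ex by (auto simp: S)
  have "i \<le> k + 1" if "i \<in> S" for i
  proof (rule ccontr)
    assume "\<not> i \<le> k + 1"
    hence "i \<in> {k + 2..n}" using that \<open>S \<subseteq> {..n}\<close> by auto
    thus False using that none by (auto simp: S)
  qed
  hence "Max S \<le> k + 1" using fin kS by (subst Max_le_iff) auto
  moreover have "k \<le> Max S" using fin kS by (rule Max_ge)
  ultimately show ?thesis by (auto simp: max_induced_tree_size_def S_def)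
qed

lemma prob_max_induced_tree_size_ge:
  fixes p :: real
  defines "b \<equiv> 1 / (1 - p)"
  assumes p: "0 < p" "p < 1" and k: "0 < k" and kn: "2 * k ^ 2 \<le> n"
    and lower: "b powr ((real k - 5/2) / 2) \<le> exp 1 * real n * p"
    and upper: "exp 1 * real n * p \<le> b powr ((real k - 3/2) / 2)"
    and small: "exp 1 * p * max 1 ((1 - p) / p) * real k ^ 3 * b powr (5/4 - real k / 4) \<le> 1"
      "real k ^ 2 * exp (2 * sqrt (real k * (p / (1 - p)))) * b powr (- real k / 4) \<le> 1"
  shows "1 - no_tree_bound p k - (1 - p) / p * ((b powr (- 1 / 4)) ^ k / (1 - b powr (- 1 / 4)))
    \<le> measure_pmf.prob (binomial_random_graph n p) {G. max_induced_tree_size G \<in> {k, k + 1}}"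
proof -
  let ?M = "binomial_random_graph n p"
  let ?A = "{G. max_induced_tree_size G \<in> {k, k + 1}}"
  let ?E = "\<Union>W\<in>{W. W \<subseteq> {1..n} \<and> card W = k}. tree_event W"
  let ?B = "\<Union>i\<in>{k + 2..n}. \<Union>W\<in>{W. W \<subseteq> {1..n} \<and> card W = i}. tree_event W"
  have "measure_pmf.prob ?M ?E = measure_pmf.prob ?M (?E \<inter> set_pmf ?M)"
    by (rule measure_Int_set_pmf[symmetric])
  also have "\<dots> \<le> measure_pmf.prob ?M (?A \<union> ?B)"
  proof (rule measure_pmf.finite_measure_mono)
    show "?E \<inter> set_pmf ?M \<subseteq> ?A \<union> ?B"
      using max_induced_tree_size_between[of _ n p k] by blast
  qed auto
  also have "\<dots> \<le> measure_pmf.prob ?M ?A + measure_pmf.prob ?M ?B"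
    by (rule measure_subadditive) auto
  finally have "measure_pmf.prob ?M ?E \<le> measure_pmf.prob ?M ?A + measure_pmf.prob ?M ?B" .
  moreover have "1 - measure_pmf.prob ?M ?E \<le> no_tree_bound p k"
    using lower small unfolding b_def by (intro prob_no_induced_tree_le p k kn)
  moreover have "measure_pmf.prob ?M ?B \<le> (1 - p) / p * ((b powr (- 1 / 4)) ^ k / (1 - b powr (- 1 / 4)))"
    using upper unfolding b_def by (intro prob_large_induced_tree_le p)
  ultimately show ?thesis by linarith
qed

theorem theorem2:
  fixes p :: real
  assumes "0 < p" and "p < 1"
  shows "\<exists>\<epsilon>>0. (\<lambda>n. measure_pmf.prob (binomial_random_graph n p)
           {G. int (max_induced_tree_size G) \<in> {tree_threshold p \<epsilon> n, tree_threshold p \<epsilon> n + 1}})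
         \<longlonglongrightarrow> 1"
proof (intro exI[of _ "1/2"] conjI)
  note p = assms
  define b where "b = 1 / (1 - p)"
  have b: "b > 1" using p by (simp add: b_def)
  \<comment> \<open>The expected number of induced trees passes from large to small at the size \<open>2 * log b (exp 1 * n * p) + 3\<close>. With \<open>\<epsilon> = 1/2\<close> the threshold stays at least \<open>1/2\<close> below it, and the threshold plus two lies more than \<open>1/2\<close> above it.\<close>
  define x where "x n = 2 * log b (exp 1 * real n * p) + 2 + 1/2" for n
  define k where "k n = nat (tree_threshold p (1/2) n)" for n
  have thr: "tree_threshold p (1/2) n = \<lfloor>x n\<rfloor>" for n
    by (simp add: tree_threshold_def x_def b_def)
  have lnb: "ln b > 0" using b by simp
  have x_top: "filterlim x at_top sequentially"
    unfolding x_def[abs_def] log_def using lnb p by real_asymp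
  have square: "\<forall>\<^sub>F n in sequentially. 2 * (x n)\<^sup>2 \<le> real n"
    unfolding x_def[abs_def] log_def using lnb p by real_asymp
  have k_top: "filterlim k at_top sequentially"
    unfolding filterlim_at_top
  proof
    fix Z :: nat
    have "\<forall>\<^sub>F n in sequentially. real Z \<le> x n" using x_top unfolding filterlim_at_top by blast
    thus "\<forall>\<^sub>F n in sequentially. Z \<le> k n"
      by eventually_elim (simp add: k_def thr le_nat_floor)
  qed
  define err where "err k = no_tree_bound p k
    + (1 - p) / p * ((b powr (- 1 / 4)) ^ k / (1 - b powr (- 1 / 4)))" for k
  have "err \<longlonglongrightarrow> 0 + (1 - p) / p * (0 / (1 - b powr (- 1 / 4)))"
    unfolding err_def[abs_def] using b
    by (intro tendsto_intros no_tree_bound_tendsto_0(1) p LIMSEQ_realpow_zero)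
       (auto simp: powr_less_one)
  hence "err \<longlonglongrightarrow> 0" by simp
  hence err: "(\<lambda>n. 1 - err (k n)) \<longlonglongrightarrow> 1"
    using tendsto_diff[OF tendsto_const filterlim_compose[OF _ k_top, of err "nhds 0"], of 1] by simp
  show "(\<lambda>n. measure_pmf.prob (binomial_random_graph n p)
           {G. int (max_induced_tree_size G) \<in> {tree_threshold p (1/2) n, tree_threshold p (1/2) n + 1}})
         \<longlonglongrightarrow> 1"
  proof (rule tendsto_sandwich[OF _ _ err tendsto_const])
    have small1: "\<forall>\<^sub>F n in sequentially. exp 1 * p * max 1 ((1 - p) / p) * real (k n) ^ 3 * b powr (5/4 - real (k n) / 4) \<le> 1"
      using filterlim_iff[THEN iffD1, OF k_top, rule_format, OF no_tree_bound_tendsto_0(2)[OF p]] by (simp add: b_def)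
    have small2: "\<forall>\<^sub>F n in sequentially. real (k n) ^ 2 * exp (2 * sqrt (real (k n) * (p / (1 - p)))) * b powr (- real (k n) / 4) \<le> 1"
      using filterlim_iff[THEN iffD1, OF k_top, rule_format, OF no_tree_bound_tendsto_0(3)[OF p]] by (simp add: b_def)
    have "\<forall>\<^sub>F n in sequentially. 1 \<le> x n" using x_top unfolding filterlim_at_top by blast
    thus "\<forall>\<^sub>F n in sequentially. 1 - err (k n) \<le> measure_pmf.prob (binomial_random_graph n p)
           {G. int (max_induced_tree_size G) \<in> {tree_threshold p (1/2) n, tree_threshold p (1/2) n + 1}}"
      using small1 small2 square eventually_gt_at_top[of 0]
    proof eventually_elim
      case (elim n)
      have fl: "tree_threshold p (1/2) n = int (k n)" "k n > 0"
        using elim(1) by (auto simp: k_def thr)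
      have kx: "real (k n) \<le> x n" "x n < real (k n) + 1"
        using fl by (simp_all add: thr) linarith+
      have pos: "exp 1 * real n * p > 0" using elim p by simp
      have enp: "b powr log b (exp 1 * real n * p) = exp 1 * real n * p"
        using b pos by simp
      have "real (k n) ^ 2 \<le> x n ^ 2" using kx by (intro power_mono) auto
      hence "2 * real (k n) ^ 2 \<le> real n" using elim by linarith
      hence "real (2 * k n ^ 2) \<le> real n" by simp
      hence kn: "2 * k n ^ 2 \<le> n" by (simp only: of_nat_le_iff)
      have "b powr ((real (k n) - 5/2) / 2) \<le> b powr log b (exp 1 * real n * p)"
        using b kx by (intro powr_mono) (auto simp: x_def)
      hence lower: "b powr ((real (k n) - 5/2) / 2) \<le> exp 1 * real n * p" unfolding enp .
      have "b powr log b (exp 1 * real n * p) \<le> b powr ((real (k n) - 3/2) / 2)"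
        using b kx by (intro powr_mono) (auto simp: x_def)
      hence upper: "exp 1 * real n * p \<le> b powr ((real (k n) - 3/2) / 2)" unfolding enp .
      have "1 - err (k n) \<le> measure_pmf.prob (binomial_random_graph n p)
          {G. max_induced_tree_size G \<in> {k n, k n + 1}}"
        using prob_max_induced_tree_size_ge[OF p fl(2) kn, folded b_def] lower upper elim(2,3)
        by (simp add: err_def)
      also have "{G. max_induced_tree_size G \<in> {k n, k n + 1}}
          = {G. int (max_induced_tree_size G) \<in> {tree_threshold p (1/2) n, tree_threshold p (1/2) n + 1}}"
        unfolding fl(1) by auto
      finally show ?case .
    qed
  qed simp
qed simp

end
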